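(* Let $R=k[x_1,x_2,x_3]$ and let $A=R/I$ be a graded Artinian algebra with socle degree $s$ and Hilbert function $(h_0,h_1,\dots,h_s)$ satisfying $h_{d-1}>h_d=h_{d+1}$ for some $d$. If $\beta_{1,d+2}(I^{\rm lex})=\beta_{2,d+2}(I^{\rm lex})$ for this $d$, where $d<s$, then $A$ is not level.
   Context: $k$ is an infinite field of characteristic $0$; $h_i=\dim_kA_i$, $A_s\ne0$. $A$ is level if its socle $\{a\in A:a\mathfrak m=0\}$ ($\mathfrak m$ the maximal homogeneous ideal) is concentrated in a single degree. $\beta_{p,q}(J)=\dim_k\mathrm{Tor}_p^R(J,k)_q$. $I^{\rm lex}$ is the lex-segment ideal: for each degree $t$, $(I^{\rm lex})_t$ is spanned by the $\dim_kI_t$ largest monomials of degree $t$ in lexicographic order with $x_1>x_2>x_3$. *)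

theory Defs
  imports Complex_Main "HOL-Library.Function_Algebras"
begin

text \<open>Polynomials in k[x1,x2,x3] are represented as coefficient functions on
exponent vectors (a1,a2,a3), the exponent of x1 being a1, etc.  The ring R is
the set of finitely supported coefficient functions.  Variables are indexed
0,1,2 (for x1,x2,x3).\<close>

type_synonym 'k pol = "nat \<times> nat \<times> nat \<Rightarrow> 'k"

definition mdeg :: "nat \<times> nat \<times> nat \<Rightarrow> nat" where
  "mdeg m = (case m of (a, b, c) \<Rightarrow> a + b + c)"

definition polR :: "('k::field) pol set" where
  "polR = {f. finite {m. f m \<noteq> 0}}"

definition pmul :: "('k::field) pol \<Rightarrow> 'k pol \<Rightarrow> 'k pol" where
  "pmul f g = (\<lambda>(m1, m2, m3).
     \<Sum>(a1, a2, a3) \<in> {0..m1} \<times> {0..m2} \<times> {0..m3}. f (a1, a2, a3) * g (m1 - a1, m2 - a2, m3 - a3))"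

definition padd :: "('k::field) pol \<Rightarrow> 'k pol \<Rightarrow> 'k pol" where
  "padd f g = (\<lambda>m. f m + g m)"

definition psc :: "'k::field \<Rightarrow> 'k pol \<Rightarrow> 'k pol" where
  "psc c f = (\<lambda>m. c * f m)"

definition unitvec :: "nat \<Rightarrow> nat \<times> nat \<times> nat" where
  "unitvec i = (if i = 0 then (1, 0, 0) else if i = 1 then (0, 1, 0) else (0, 0, 1))"

definition xvar :: "nat \<Rightarrow> ('k::field) pol" where
  "xvar i = (\<lambda>m. if m = unitvec i then 1 else 0)"

definition homog :: "nat \<Rightarrow> ('k::field) pol \<Rightarrow> bool" where
  "homog t f \<longleftrightarrow> (\<forall>m. f m \<noteq> 0 \<longrightarrow> mdeg m = t)"

definition hcomp :: "nat \<Rightarrow> ('k::field) pol \<Rightarrow> 'k pol" where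
  "hcomp t f = (\<lambda>m. if mdeg m = t then f m else 0)"

definition homog_ideal :: "('k::field) pol set \<Rightarrow> bool" where
  "homog_ideal I \<longleftrightarrow> I \<subseteq> polR \<and> (\<lambda>_. 0) \<in> I
     \<and> (\<forall>f\<in>I. \<forall>g\<in>I. padd f g \<in> I)
     \<and> (\<forall>r\<in>polR. \<forall>f\<in>I. pmul r f \<in> I)
     \<and> (\<forall>f\<in>I. \<forall>t. hcomp t f \<in> I)"

definition Rdeg :: "nat \<Rightarrow> ('k::field) pol set" where
  "Rdeg t = {f. homog t f}"

definition kdim :: "('k::field) pol set \<Rightarrow> nat" where
  "kdim V = vector_space.dim psc V"

definition hilb :: "('k::field) pol set \<Rightarrow> nat \<Rightarrow> nat" where
  "hilb I t = kdim (Rdeg t :: 'k pol set) - kdim (I \<inter> Rdeg t)"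

definition artinian :: "('k::field) pol set \<Rightarrow> bool" where
  "artinian I \<longleftrightarrow> (\<exists>N. \<forall>t\<ge>N. hilb I t = 0)"

definition socle_degree :: "('k::field) pol set \<Rightarrow> nat \<Rightarrow> bool" where
  "socle_degree I s \<longleftrightarrow> hilb I s \<noteq> 0 \<and> (\<forall>t>s. hilb I t = 0)"

text \<open>A = R/I is level: the socle {a. a*m = 0} of A is concentrated in a single
degree e, i.e. every element of R whose products with x1,x2,x3 lie in I is
congruent modulo I to a homogeneous element of degree e.\<close>
definition level :: "('k::field) pol set \<Rightarrow> bool" where
  "level I \<longleftrightarrow> (\<exists>e. \<forall>a\<in>polR. (\<forall>i<3. pmul (xvar i) a \<in> I) \<longrightarrow>
       (\<exists>b. homog e b \<and> (\<lambda>m. a m - b m) \<in> I))"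

definition lex_gt :: "nat \<times> nat \<times> nat \<Rightarrow> nat \<times> nat \<times> nat \<Rightarrow> bool" where
  "lex_gt m n = (case m of (a1, a2, a3) \<Rightarrow> case n of (b1, b2, b3) \<Rightarrow>
     a1 > b1 \<or> (a1 = b1 \<and> (a2 > b2 \<or> (a2 = b2 \<and> a3 > b3))))"

definition toplex :: "nat \<Rightarrow> nat \<Rightarrow> (nat \<times> nat \<times> nat) set" where
  "toplex t N = {m. mdeg m = t \<and> card {m'. mdeg m' = t \<and> lex_gt m' m} < N}"

definition lexI :: "('k::field) pol set \<Rightarrow> 'k pol set" where
  "lexI I = {f \<in> polR. \<forall>m. f m \<noteq> 0 \<longrightarrow> m \<in> toplex (mdeg m) (kdim (I \<inter> Rdeg (mdeg m)))}"

text \<open>Tor_p^R(J,k)_q computed from the Koszul resolution of k (tensored with J):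
chains in homological degree p, internal degree q are families (F S) indexed by
p-subsets S of {0,1,2}, with F S \<in> J_(q-p).\<close>
definition kchains :: "('k::field) pol set \<Rightarrow> nat \<Rightarrow> nat \<Rightarrow> (nat set \<Rightarrow> 'k pol) set" where
  "kchains J p q = {F. (\<forall>S. F S \<noteq> (\<lambda>_. 0) \<longrightarrow> S \<subseteq> {0, 1, 2} \<and> card S = p \<and> p \<le> q)
        \<and> (\<forall>S. F S \<in> J \<and> homog (q - p) (F S))}"

definition ksign :: "nat \<Rightarrow> nat set \<Rightarrow> 'k::field" where
  "ksign i S = (- 1) ^ card {j \<in> S. j < i}"

text \<open>Koszul differential: e_T \<otimes> f \<mapsto> \<Sum>_{i\<in>T} (-1)^{#{j\<in>T. j<i}} x_i f e_{T-{i}}.\<close>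
definition kdiff :: "(nat set \<Rightarrow> ('k::field) pol) \<Rightarrow> nat set \<Rightarrow> 'k pol" where
  "kdiff F S = (\<lambda>m. \<Sum>i \<in> {0, 1, 2} - S. ksign i S * pmul (xvar i) (F (insert i S)) m)"

definition csc :: "'k::field \<Rightarrow> (nat set \<Rightarrow> 'k pol) \<Rightarrow> nat set \<Rightarrow> 'k pol" where
  "csc c F = (\<lambda>S m. c * F S m)"

definition betti :: "('k::field) pol set \<Rightarrow> nat \<Rightarrow> nat \<Rightarrow> nat" where
  "betti J p q = vector_space.dim csc {F \<in> kchains J p q. kdiff F = (\<lambda>_. (\<lambda>_. 0))}
                 - vector_space.dim csc (kdiff ` kchains J (Suc p) q)"

end

theory Submission
  imports Defs "HOL-Computational_Algebra.Polynomial"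
begin

text \<open>
  Suppose that A is level; then its socle vanishes in degrees d - 1 and d. Put V = I_{d+1} and
  let x V denote the span of the products of V with the variables. The equality of the Betti numbers
  means exactly that the span of the products of (I^lex)_{d+1} with the variables has codimension
  h_{d-1} in degree d + 2,
  and by the exactness of the Koszul complex the vanishing of the socle in degree d - 1 bounds
  the codimension of x V from below by the same number. Green's hyperplane restriction theorem in three variables
  provides a linear form L such that b, the codimension of V + L R_d in degree d + 1, is at most
  the excess of that growth: counting monomials for the lex-segment, h_{d-1} \<ge> h_{d+1} + b. Since
  x V + L R_{d+1} has codimension at most b, multiplication by L is injective from R_{d+1}/V to R_{d+2}/x V.
  On the other hand h_{d-1} > h_d gives a nonzero v in A_{d-1} with L v = 0; some x_i v is nonzero because the
  socle vanishes in degree d - 1, so there is a nonzero u in A_d with L u = 0. Then L (x_i u) = x_i (L u) lies in x V,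
  so x_i u = 0 in A for all i, and u is a socle element of degree d.

  Green's theorem needs generic linear forms. All linear forms are normalised to
  L = x_3 - \<alpha> x_1 - \<beta> x_2, and genericity is obtained on pencils of such forms: the rank of a
  pencil of linear maps drops only at finitely many parameters, since these come from eigenvalues.
\<close>

section \<open>Dimensions of finite-dimensional subspaces\<close>

definition ssum :: "'a::plus set \<Rightarrow> 'a set \<Rightarrow> 'a set" where
  "ssum V W = {v + w |v w. v \<in> V \<and> w \<in> W}"

text \<open>The space of all coefficient functions is infinite-dimensional, so finiteness is a
  predicate \<open>fdim\<close> on subsets and not an axiom on the whole space.\<close>

locale fd_space = vector_space scale for scale :: "'a::field \<Rightarrow> 'b::ab_group_add \<Rightarrow> 'b"
begin

definition fdim :: "'b set \<Rightarrow> bool" where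
  "fdim V \<longleftrightarrow> (\<exists>B. finite B \<and> V \<subseteq> span B)"

lemma fdim_mono: "fdim W \<Longrightarrow> V \<subseteq> W \<Longrightarrow> fdim V"
  unfolding fdim_def by blast

lemma fdim_basis:
  assumes "fdim V"
  obtains B where "finite B" "B \<subseteq> V" "independent B" "V \<subseteq> span B" "card B = dim V"
proof -
  obtain B where B: "B \<subseteq> V" "independent B" "V \<subseteq> span B" "card B = dim V"
    using basis_exists by blast
  moreover have "finite B"
    using assms B independent_span_bound unfolding fdim_def by blast
  ultimately show thesis using that by blast
qed

lemma independent_card_le:
  assumes "independent B" "B \<subseteq> V" "fdim V"
  shows "finite B \<and> card B \<le> dim V"
proof -
  obtain C where "finite C" "V \<subseteq> span C" "card C = dim V" using fdim_basis[OF assms(3)] by metis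
  then show ?thesis using independent_span_bound[OF _ assms(1), of C] assms(2) by auto
qed

lemma dim_mono_fdim:
  assumes "V \<subseteq> W" "fdim W"
  shows "dim V \<le> dim W"
  by (metis assms basis_exists independent_card_le subset_trans)

text \<open>A vector of W outside the span of a basis of V would extend that basis to an independent
  subset of W with more than dim W elements.\<close>

lemma subspace_eqI_dim:
  assumes "subspace V" "V \<subseteq> W" "fdim W" "dim W \<le> dim V"
  shows "V = W"
proof -
  obtain B where B: "B \<subseteq> V" "independent B" "V \<subseteq> span B" "card B = dim V"
    using basis_exists by blast
  have "W \<subseteq> span B"
  proof
    fix x assume x: "x \<in> W"
    show "x \<in> span B"
    proof (rule ccontr)
      assume n: "x \<notin> span B"
      then have "independent (insert x B)" by (simp add: B(2) independent_insertI)
      moreover have "insert x B \<subseteq> W" using x B(1) assms(2) by blast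
      ultimately have "finite (insert x B) \<and> card (insert x B) \<le> dim W"
        using assms(3) by (rule independent_card_le)
      moreover have "x \<notin> B" using n span_base by blast
      ultimately show False using B(4) assms(4) by auto
    qed
  qed
  also have "span B \<subseteq> V" using B(1) assms(1) by (rule span_minimal)
  finally show ?thesis using assms(2) by blast
qed

lemma subspace_ssum: "subspace V \<Longrightarrow> subspace W \<Longrightarrow> subspace (ssum V W)"
  unfolding ssum_def by (rule subspace_sums)

lemma ssum_subset: "subspace U \<Longrightarrow> V \<subseteq> U \<Longrightarrow> W \<subseteq> U \<Longrightarrow> ssum V W \<subseteq> U"
  unfolding ssum_def by (auto intro: subspace_add)

lemma ssum_upper:
  "subspace W \<Longrightarrow> V \<subseteq> ssum V W" "subspace V \<Longrightarrow> W \<subseteq> ssum V W"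
  unfolding ssum_def using subspace_0 by force+

lemma fdim_ssum:
  assumes "fdim V" "fdim W"
  shows "fdim (ssum V W)"
proof -
  obtain A B where "finite A" "V \<subseteq> span A" "finite B" "W \<subseteq> span B"
    using assms unfolding fdim_def by blast
  then have "finite (A \<union> B)" "ssum V W \<subseteq> span (A \<union> B)"
    by (auto simp: span_Un ssum_def)
  then show ?thesis unfolding fdim_def by blast
qed

end

section \<open>Rank and nullity of a linear map on a finite-dimensional subspace\<close>

locale fd_space_pair = vs1: fd_space s1 + vs2: fd_space s2
  for s1 :: "'a::field \<Rightarrow> 'b::ab_group_add \<Rightarrow> 'b"
    and s2 :: "'a \<Rightarrow> 'c::ab_group_add \<Rightarrow> 'c"
begin

sublocale vector_space_pair s1 s2 ..


lemma fdim_image: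
  assumes "Vector_Spaces.linear s1 s2 f" "vs1.fdim V"
  shows "vs2.fdim (f ` V)"
proof -
  interpret f: Vector_Spaces.linear s1 s2 f by fact
  show ?thesis using assms(2) f.spans_image unfolding vs1.fdim_def vs2.fdim_def by blast
qed

text \<open>A basis \<open>B0\<close> of the kernel extends to a basis \<open>B\<close> of V; the
  added vectors \<open>C\<close> span a complement on which f is injective, so their images form a
  basis of the image.\<close>

lemma rank_nullity:
  assumes f: "Vector_Spaces.linear s1 s2 f" and V: "vs1.subspace V" "vs1.fdim V"
  shows "vs1.dim V = vs2.dim (f ` V) + vs1.dim {x \<in> V. f x = 0}"
proof -
  interpret f: Vector_Spaces.linear s1 s2 f by fact
  let ?K = "{x \<in> V. f x = 0}"
  obtain B0 where B0: "B0 \<subseteq> ?K" "vs1.independent B0" "?K \<subseteq> vs1.span B0" "card B0 = vs1.dim ?K"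
    using vs1.basis_exists by blast
  obtain B where B: "B0 \<subseteq> B" "B \<subseteq> V" "vs1.independent B" "V \<subseteq> vs1.span B"
    using vs1.maximal_independent_subset_extend[of B0 V] B0 by blast
  have cB: "card B = vs1.dim V" by (rule vs1.basis_card_eq_dim[OF B(2,4,3)])
  have fB: "finite B" using vs1.independent_card_le[OF B(3,2) V(2)] by simp
  define C where "C = B - B0"
  have spC: "vs1.span C \<subseteq> V"
    using B(2) V(1) C_def by (intro vs1.span_minimal) auto
  have spB: "vs1.span B \<subseteq> V" using B(2) V(1) by (rule vs1.span_minimal)
  have inj0: "x = 0" if x: "x \<in> vs1.span C" and fx: "f x = 0" for x
  proof -
    have "x \<in> V" using x spC by blast
    then have x0: "x \<in> vs1.span B0" using fx B0(3) by blast
    \<comment> \<open>The coordinates of x with respect to \<open>B\<close> are supported on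
      \<open>C\<close> and also on \<open>B0\<close>; these sets are disjoint, so all coordinates
      vanish.\<close>
    have r: "vs1.representation B x = vs1.representation C x"
            "vs1.representation B x = vs1.representation B0 x"
      using vs1.representation_extend[OF B(3) x] vs1.representation_extend[OF B(3) x0] B(1)
      by (auto simp: C_def)
    have "vs1.representation B x b = 0" for b
      using r vs1.representation_ne_zero[of C x b] vs1.representation_ne_zero[of B0 x b]
      unfolding C_def by fastforce
    moreover have "x \<in> vs1.span B" using x vs1.span_mono[of C B] unfolding C_def by blast
    ultimately show "x = 0"
      using vs1.sum_nonzero_representation_eq[OF B(3), of x] by simp
  qed
  have inj: "inj_on f (vs1.span C)"
  proof (rule inj_onI)
    fix x y assume "x \<in> vs1.span C" "y \<in> vs1.span C" "f x = f y"
    then have "x - y = 0" by (intro inj0) (auto simp: f.diff vs1.span_diff)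
    then show "x = y" by simp
  qed
  have iC: "vs2.independent (f ` C)"
    using f.independent_injective_image[OF _ inj] vs1.independent_mono[OF B(3)] C_def by blast
  have "f ` V \<subseteq> vs2.span (f ` C)"
  proof
    fix y assume "y \<in> f ` V"
    then have "y \<in> vs2.span (f ` B)" using f.spans_image[OF B(4)] by blast
    moreover have "f ` B \<subseteq> insert 0 (f ` C)" using B0(1) unfolding C_def by auto
    ultimately show "y \<in> vs2.span (f ` C)"
      using vs2.span_mono vs2.span_insert_0 by blast
  qed
  then have "card (f ` C) = vs2.dim (f ` V)"
    using iC B(2) unfolding C_def by (intro vs2.basis_card_eq_dim) auto
  moreover have "card (f ` C) = card C"
    using inj vs1.span_superset by (intro card_image) (metis inj_on_subset)
  moreover have "card B = card C + card B0"
    unfolding C_def using B(1) fB by (simp add: card_Diff_subset card_mono finite_subset)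
  ultimately show ?thesis using cB B0(4) by simp
qed

lemma dim_image_inj:
  assumes f: "Vector_Spaces.linear s1 s2 f" and V: "vs1.subspace V" "vs1.fdim V"
    and inj: "\<And>x. x \<in> V \<Longrightarrow> f x = 0 \<Longrightarrow> x = 0"
  shows "vs2.dim (f ` V) = vs1.dim V"
proof -
  have "{x \<in> V. f x = 0} = {0}"
    using inj vs1.subspace_0[OF V(1)] f by (auto simp: linear_0)
  moreover have "vs1.dim {0} = 0" using vs1.dim_le_card[of "{0}" "{}"] by simp
  ultimately show ?thesis using rank_nullity[OF f V] by simp
qed

end

section \<open>Sums of subspaces, eigenvalues, and pencils of linear maps\<close>

context fd_space
begin

text \<open>The map x - q x for a projection q onto V. It plays the role of the quotient map by V
  while staying inside the given space.\<close>

lemma linear_with_kernel: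
  assumes "subspace V"
  obtains p where "Vector_Spaces.linear scale scale p" "\<And>x. p x = 0 \<longleftrightarrow> x \<in> V"
proof -
  interpret vs: fd_space_pair scale scale ..
  obtain q where q: "range q \<subseteq> V" "Vector_Spaces.linear scale scale q" "\<And>v. v \<in> V \<Longrightarrow> q v = v"
    using vs.linear_exists_left_inverse_on[OF linear_ident assms] by auto
  have "Vector_Spaces.linear scale scale (\<lambda>x. x - q x)"
    using vs.module_hom_sub[of "\<lambda>x. x" q] q(2) linear_ident
    by (simp add: module_hom_iff_linear)
  moreover have "x - q x = 0 \<longleftrightarrow> x \<in> V" for x using q(1,3) by (metis eq_iff_diff_eq_0 range_subsetD)
  ultimately show thesis using that by blast
qed

lemma dim_ssum_kernel:
  assumes V: "subspace V" "fdim V" and U: "subspace U" "fdim U"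
    and p: "Vector_Spaces.linear scale scale p" "\<And>x. p x = 0 \<longleftrightarrow> x \<in> V"
  shows "dim (ssum V U) = dim V + dim (p ` U)"
proof -
  interpret vs: fd_space_pair scale scale ..
  interpret p: Vector_Spaces.linear scale scale p by fact
  have "p ` ssum V U = p ` U"
  proof
    show "p ` ssum V U \<subseteq> p ` U" unfolding ssum_def using p(2) by (force simp: p.add)
    show "p ` U \<subseteq> p ` ssum V U" by (rule image_mono[OF ssum_upper(2)[OF V(1)]])
  qed
  moreover have "{x \<in> ssum V U. p x = 0} = V" using p(2) ssum_upper(1)[OF U(1)] by blast
  ultimately show ?thesis
    using vs.rank_nullity[OF p(1) subspace_ssum[OF V(1) U(1)] fdim_ssum[OF V(2) U(2)]] by simp
qed

text \<open>Rank-nullity on U for f followed by a map with kernel V. It links the sum V + f(U) to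
  the colon space of all u with f u in V; with f a linear form it is the basic dimension count of
  the proof.\<close>

lemma dim_ssum_image:
  assumes V: "subspace V" "fdim V" and U: "subspace U" "fdim U"
    and f: "Vector_Spaces.linear scale scale f"
  shows "dim (ssum V (f ` U)) + dim {u \<in> U. f u \<in> V} = dim V + dim U"
proof -
  interpret vs: fd_space_pair scale scale ..
  interpret f: Vector_Spaces.linear scale scale f by fact
  obtain p where p: "Vector_Spaces.linear scale scale p" "\<And>x. p x = 0 \<longleftrightarrow> x \<in> V"
    using linear_with_kernel[OF V(1)] by blast
  have "dim (ssum V (f ` U)) = dim V + dim ((p \<circ> f) ` U)"
    using dim_ssum_kernel[OF V f.subspace_image[OF U(1)] vs.fdim_image[OF f U(2)] p]
    by (simp add: image_comp)
  moreover have "dim U = dim ((p \<circ> f) ` U) + dim {u \<in> U. (p \<circ> f) u = 0}"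
    by (rule vs.rank_nullity[OF Vector_Spaces.linear_compose[OF f p(1)] U])
  ultimately show ?thesis using p(2) by simp
qed

text \<open>Indexing the eigenvectors by their eigenvalues makes the eigenvalues distinct. Applying
  T to a relation and subtracting e times the relation removes the term of e.\<close>

lemma eigenvectors_independent:
  assumes T: "Vector_Spaces.linear scale scale T"
    and "finite C" and "\<And>c. c \<in> C \<Longrightarrow> T (y c) = scale c (y c) \<and> y c \<noteq> 0"
  shows "(\<Sum>c\<in>C. scale (a c) (y c)) = 0 \<Longrightarrow> c \<in> C \<Longrightarrow> a c = 0"
  using assms(2,3)
proof (induction C arbitrary: a c rule: finite_induct)
  case empty
  then show ?case by simp
next
  case (insert e C)
  interpret T: Vector_Spaces.linear scale scale T by fact
  have e: "scale (a e) (y e) + (\<Sum>c\<in>C. scale (a c) (y c)) = 0"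
    using insert by simp
  then have "T (scale (a e) (y e) + (\<Sum>c\<in>C. scale (a c) (y c))) = 0" by simp
  then have "scale (a e) (scale e (y e)) + (\<Sum>c\<in>C. scale (a c) (scale c (y c))) = 0"
    using insert.prems(3) by (simp add: T.add T.scale T.sum)
  moreover have "scale e (scale (a e) (y e)) + (\<Sum>c\<in>C. scale e (scale (a c) (y c))) = 0"
    using e by (metis scale_right_distrib scale_sum_right scale_zero_right)
  ultimately have "(\<Sum>c\<in>C. scale (a c) (scale c (y c))) - (\<Sum>c\<in>C. scale e (scale (a c) (y c))) = 0"
    by (simp add: scale_left_commute add_eq_0_iff)
  then have "(\<Sum>c\<in>C. scale (a c * (c - e)) (y c)) = 0"
    by (simp add: sum_subtractf[symmetric] algebra_simps)
  then have "a c * (c - e) = 0" if "c \<in> C" for c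
    using insert.IH[of "\<lambda>c. a c * (c - e)"] insert.prems(3) that by blast
  then have z: "a c = 0" if "c \<in> C" for c using that insert.hyps(2) by fastforce
  then have "scale (a e) (y e) = 0" using e by simp
  then have "a e = 0" using insert.prems(3)[of e] by simp
  then show ?case using z insert.prems(2) by blast
qed

lemma finite_eigenvalues:
  assumes T: "Vector_Spaces.linear scale scale T" and F: "fdim F"
  shows "finite {c. \<exists>y\<in>F. y \<noteq> 0 \<and> T y = scale c y}"
proof (rule ccontr)
  assume inf: "infinite {c. \<exists>y\<in>F. y \<noteq> 0 \<and> T y = scale c y}"
  obtain C where C: "finite C" "card C = Suc (dim F)" "C \<subseteq> {c. \<exists>y\<in>F. y \<noteq> 0 \<and> T y = scale c y}"
    using infinite_arbitrarily_large[OF inf] by blast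
  then have "\<forall>c\<in>C. \<exists>y. y \<in> F \<and> y \<noteq> 0 \<and> T y = scale c y" by blast
  then obtain y where y: "\<And>c. c \<in> C \<Longrightarrow> y c \<in> F \<and> y c \<noteq> 0 \<and> T (y c) = scale c (y c)"
    by metis
  have inj: "inj_on y C"
  proof (rule inj_onI)
    fix a b assume "a \<in> C" "b \<in> C" "y a = y b"
    then show "a = b" using y[of a] y[of b] by (metis scale_cancel_right)
  qed
  have "independent (y ` C)"
  proof (rule independent_if_scalars_zero)
    show "finite (y ` C)" using C(1) by simp
    fix f x assume s: "(\<Sum>x\<in>y ` C. scale (f x) x) = 0" and "x \<in> y ` C"
    then obtain c where c: "c \<in> C" "x = y c" by blast
    have "(\<Sum>c\<in>C. scale (f (y c)) (y c)) = 0" using s by (simp add: sum.reindex[OF inj])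
    then show "f x = 0"
      using eigenvectors_independent[OF T C(1), of y "\<lambda>c. f (y c)" c] y c by auto
  qed
  then have "card (y ` C) \<le> dim F" using independent_card_le[of "y ` C" F] y F by blast
  then show False using C(2) card_image[OF inj] by simp
qed

text \<open>Let s be a section of f over F = f(U), q a projection onto F, and T = q g s. If f + c g
  has rank below dim F, then (f + c g) s kills a nonzero y in F; applying q gives y + c T y = 0, so
  -1/c is an eigenvalue of T.\<close>

lemma pencil_image:
  assumes f: "Vector_Spaces.linear scale scale f" and g: "Vector_Spaces.linear scale scale g"
    and U: "subspace U" "fdim U"
  shows "finite {c. dim ((\<lambda>u. f u + scale c (g u)) ` U) < dim (f ` U)}"
proof -
  interpret vs: fd_space_pair scale scale ..
  interpret f: Vector_Spaces.linear scale scale f by fact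
  interpret g: Vector_Spaces.linear scale scale g by fact
  define F where "F = f ` U"
  have F: "subspace F" "fdim F"
    unfolding F_def by (rule f.subspace_image[OF U(1)], rule vs.fdim_image[OF f U(2)])
  obtain s where s: "range s \<subseteq> U" "Vector_Spaces.linear scale scale s" "\<And>v. v \<in> F \<Longrightarrow> f (s v) = v"
    using vs.linear_exists_right_inverse_on[OF f U(1)] unfolding F_def by auto
  obtain q where q: "range q \<subseteq> F" "Vector_Spaces.linear scale scale q" "\<And>v. v \<in> F \<Longrightarrow> q v = v"
    using vs.linear_exists_left_inverse_on[OF linear_ident F(1)] by auto
  interpret s: Vector_Spaces.linear scale scale s by fact
  interpret q: Vector_Spaces.linear scale scale q by fact
  define T where "T = (\<lambda>y. q (g (s y)))"
  have T: "Vector_Spaces.linear scale scale T"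
    using Vector_Spaces.linear_compose[OF s(2) Vector_Spaces.linear_compose[OF g q(2)]]
    by (simp add: T_def comp_def)
  let ?E = "{c. \<exists>y\<in>F. y \<noteq> 0 \<and> T y = scale c y}"
  have "{c. dim ((\<lambda>u. f u + scale c (g u)) ` U) < dim (f ` U)} \<subseteq> (\<lambda>e. - (1 / e)) ` ?E"
  proof
    fix c assume c: "c \<in> {c. dim ((\<lambda>u. f u + scale c (g u)) ` U) < dim (f ` U)}"
    define h where "h = (\<lambda>u. f u + scale c (g u))"
    have h: "Vector_Spaces.linear scale scale h"
      using vs.module_hom_add[of f "\<lambda>u. scale c (g u)"] vs.module_hom_scale[of g c] f g
      by (simp add: module_hom_iff_linear h_def)
    have hs: "Vector_Spaces.linear scale scale (\<lambda>y. h (s y))"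
      using Vector_Spaces.linear_compose[OF s(2) h] by (simp add: comp_def)
    have "\<exists>y\<in>F. y \<noteq> 0 \<and> h (s y) = 0"
    proof (rule ccontr)
      assume "\<not> ?thesis"
      then have "dim ((\<lambda>y. h (s y)) ` F) = dim F"
        using vs.dim_image_inj[OF hs F] by blast
      moreover have "dim ((\<lambda>y. h (s y)) ` F) \<le> dim (h ` U)"
        using s(1) by (intro dim_mono_fdim vs.fdim_image[OF h U(2)]) auto
      ultimately show False using c unfolding h_def F_def by simp
    qed
    then obtain y where y: "y \<in> F" "y \<noteq> 0" "h (s y) = 0" by blast
    have "q (h (s y)) = y + scale c (T y)"
      using y(1) s(3) q(3) by (simp add: h_def T_def q.add q.scale)
    then have e: "y + scale c (T y) = 0" using y(3) by simp
    have c0: "c \<noteq> 0" using e y(2) by auto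
    have "scale (1 / c) (y + scale c (T y)) = 0" using e by simp
    then have "T y = scale (- (1 / c)) y"
      using c0 by (simp add: scale_right_distrib eq_neg_iff_add_eq_0 add.commute del: minus_divide_left)
    then have "- (1 / c) \<in> ?E" using y(1,2) by blast
    then show "c \<in> (\<lambda>e. - (1 / e)) ` ?E" by (rule rev_image_eqI) simp
  qed
  then show ?thesis using finite_eigenvalues[OF T F(2)] by (meson finite_imageI finite_subset)
qed

text \<open>Composing f and g with a map of kernel V reduces this to
  \<open>pencil_image\<close>.\<close>

lemma pencil_ssum:
  assumes V: "subspace V" "fdim V" and U: "subspace U" "fdim U"
    and f: "Vector_Spaces.linear scale scale f" and g: "Vector_Spaces.linear scale scale g"
  shows "finite {c. dim (ssum V ((\<lambda>u. f u + scale c (g u)) ` U)) < dim (ssum V (f ` U))}"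
proof -
  interpret vs: fd_space_pair scale scale ..
  obtain p where p: "Vector_Spaces.linear scale scale p" "\<And>x. p x = 0 \<longleftrightarrow> x \<in> V"
    using linear_with_kernel[OF V(1)] by blast
  interpret p: Vector_Spaces.linear scale scale p by fact
  have pf: "Vector_Spaces.linear scale scale (p \<circ> f)" "Vector_Spaces.linear scale scale (p \<circ> g)"
    by (rule Vector_Spaces.linear_compose[OF f p(1)], rule Vector_Spaces.linear_compose[OF g p(1)])
  have dim_eq: "dim (ssum V (h ` U)) = dim V + dim ((p \<circ> h) ` U)"
    if h: "Vector_Spaces.linear scale scale h" for h
  proof -
    interpret h: Vector_Spaces.linear scale scale h by fact
    show ?thesis
      using dim_ssum_kernel[OF V h.subspace_image[OF U(1)] vs.fdim_image[OF h U(2)] p]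
      by (simp add: image_comp)
  qed
  have lin: "Vector_Spaces.linear scale scale (\<lambda>u. f u + scale c (g u))" for c
    using vs.module_hom_add[of f "\<lambda>u. scale c (g u)"] vs.module_hom_scale[of g c] f g
    by (simp add: module_hom_iff_linear)
  have "p \<circ> (\<lambda>u. f u + scale c (g u)) = (\<lambda>u. (p \<circ> f) u + scale c ((p \<circ> g) u))" for c
    by (auto simp: p.add p.scale)
  then have "dim (ssum V ((\<lambda>u. f u + scale c (g u)) ` U))
      = dim V + dim ((\<lambda>u. (p \<circ> f) u + scale c ((p \<circ> g) u)) ` U)" for c
    by (subst dim_eq[OF lin]) simp
  then have "{c. dim (ssum V ((\<lambda>u. f u + scale c (g u)) ` U)) < dim (ssum V (f ` U))}
      = {c. dim ((\<lambda>u. (p \<circ> f) u + scale c ((p \<circ> g) u)) ` U) < dim ((p \<circ> f) ` U)}"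
    using dim_eq[OF f] by (metis (no_types, lifting) add_less_cancel_left)
  then show ?thesis
    using pencil_image[OF pf U] by argo
qed

end

section \<open>Polynomials and linear forms\<close>

interpretation pol: fd_space "psc :: 'k::field \<Rightarrow> 'k pol \<Rightarrow> 'k pol"
  by unfold_locales (auto simp: psc_def fun_eq_iff algebra_simps)

interpretation polpol: fd_space_pair "psc :: 'k::field \<Rightarrow> 'k pol \<Rightarrow> 'k pol" psc ..

abbreviation plinear :: "('k::field pol \<Rightarrow> 'k pol) \<Rightarrow> bool" where
  "plinear \<equiv> Vector_Spaces.linear psc psc"

(* As a simp rule this also rewrites the psc inside pol.dim and pol.subspace;
   hence the frequent del: psc_apply below. *)
lemma psc_apply [simp]: "psc c f m = c * f m"
  by (simp add: psc_def)

section \<open>Monomials and multiplication by a variable\<close>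

definition monoms :: "nat \<Rightarrow> (nat \<times> nat \<times> nat) set" where
  "monoms t = {m. mdeg m = t}"

text \<open>Every index above 1 raises the exponent of x_3, in agreement with
  \<open>unitvec\<close>; a union over all natural numbers i therefore involves only three
  maps.\<close>

definition up :: "nat \<Rightarrow> nat \<times> nat \<times> nat \<Rightarrow> nat \<times> nat \<times> nat" where
  "up i m = (case m of (a, b, c) \<Rightarrow>
     if i = 0 then (Suc a, b, c) else if i = 1 then (a, Suc b, c) else (a, b, Suc c))"

lemma mem_monoms [simp]: "m \<in> monoms t \<longleftrightarrow> mdeg m = t"
  by (simp add: monoms_def)

lemma mdeg_up [simp]: "mdeg (up i m) = Suc (mdeg m)"
  by (auto simp: mdeg_def up_def split: prod.splits)

lemma inj_up: "inj (up i)"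
  by (auto simp: inj_def up_def split: prod.splits if_splits)

lemma up_eq_iff [simp]: "up i m = up i n \<longleftrightarrow> m = n"
  using inj_up by (auto dest: injD)

lemma mdeg_SucE:
  assumes "mdeg m = Suc t"
  obtains i m' where "i < 3" "m = up i m'"
proof -
  obtain a b c where m: "m = (a, b, c)" by (cases m)
  consider a' where "a = Suc a'" | b' where "b = Suc b'" | c' where "c = Suc c'"
    using assms m by (cases a; cases b; cases c) (auto simp: mdeg_def)
  then show thesis
  proof cases
    case 1 then show thesis using that[of 0 "(a', b, c)"] by (simp add: m up_def)
  next
    case 2 then show thesis using that[of 1 "(a, b', c)"] by (simp add: m up_def)
  next
    case 3 then show thesis using that[of 2 "(a, b, c')"] by (simp add: m up_def)
  qed
qed

lemma finite_monoms [simp]: "finite (monoms t)"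
proof (rule finite_subset)
  show "monoms t \<subseteq> {..t} \<times> {..t} \<times> {..t}" by (auto simp: mdeg_def)
qed simp

lemma pmul_xvar_apply:
  "pmul (xvar i) f (a, b, c) =
     (if i = 0 then (if a = 0 then 0 else f (a - 1, b, c))
      else if i = 1 then (if b = 0 then 0 else f (a, b - 1, c))
      else (if c = 0 then 0 else f (a, b, c - 1)))"
proof -
  have *: "(\<Sum>(a1, a2, a3) \<in> {0..a} \<times> {0..b} \<times> {0..c}. xvar i (a1, a2, a3) * f (a - a1, b - a2, c - a3))
     = (\<Sum>p \<in> {0..a} \<times> {0..b} \<times> {0..c}. if p = unitvec i then
          f (a - fst (unitvec i), b - fst (snd (unitvec i)), c - snd (snd (unitvec i))) else 0)"
    by (intro sum.cong) (auto simp: xvar_def unitvec_def split: if_splits)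
  show ?thesis
    unfolding pmul_def prod.case * by (subst sum.delta) (auto simp: unitvec_def)
qed

lemma pmul_xvar_up [simp]: "pmul (xvar i) f (up i m) = f m"
  by (cases m) (auto simp: pmul_xvar_apply up_def)

lemma pmul_xvar_nonzero: "pmul (xvar i) f m \<noteq> 0 \<Longrightarrow> \<exists>m'. m = up i m' \<and> f m' \<noteq> 0"
  by (cases m) (auto simp: pmul_xvar_apply up_def gr0_conv_Suc split: if_splits)

lemma pmul_xvar_commute: "pmul (xvar i) (pmul (xvar j) f) = pmul (xvar j) (pmul (xvar i) f)"
  by (rule ext) (auto simp: pmul_xvar_apply)

text \<open>The convolution is a finite sum for arbitrary coefficient functions, so this is linear
  on the whole function space and not only on \<open>polR\<close>.\<close>

lemma linear_pmul_xvar: "plinear (pmul (xvar i))"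
  unfolding Vector_Spaces.linear_iff
  by (auto simp: pmul_xvar_apply fun_eq_iff pol.vector_space_axioms)

lemmas pmul_xvar_simps [simp] =
  module_hom.add[OF linear_pmul_xvar[unfolded module_hom_iff_linear[symmetric]]]
  module_hom.diff[OF linear_pmul_xvar[unfolded module_hom_iff_linear[symmetric]]]
  module_hom.scale[OF linear_pmul_xvar[unfolded module_hom_iff_linear[symmetric]]]
  module_hom.zero[OF linear_pmul_xvar[unfolded module_hom_iff_linear[symmetric]]]

lemma pmul_xvar_inj: "pmul (xvar i) f = 0 \<Longrightarrow> f = 0"
  using pmul_xvar_up[of i f] by (metis ext zero_fun_apply)

section \<open>Spaces spanned by monomials\<close>

definition supported :: "(nat \<times> nat \<times> nat) set \<Rightarrow> 'k::field pol set" where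
  "supported S = {f. \<forall>m. f m \<noteq> 0 \<longrightarrow> m \<in> S}"

definition xmon :: "nat \<times> nat \<times> nat \<Rightarrow> 'k::field pol" where
  "xmon m = (\<lambda>m'. if m' = m then 1 else 0)"

lemma pmul_xvar_xmon: "pmul (xvar i) (xmon m) = xmon (up i m)"
  by (cases m) (auto simp: fun_eq_iff pmul_xvar_apply xmon_def up_def)

lemma Rdeg_eq_supported: "Rdeg t = supported (monoms t)"
  by (auto simp: Rdeg_def homog_def supported_def)

lemma subspace_supported: "pol.subspace (supported S)"
  by (rule pol.subspaceI) (auto simp: supported_def, metis add.right_neutral)

lemma xmon_in_supported: "m \<in> S \<Longrightarrow> xmon m \<in> supported S"
  by (auto simp: supported_def xmon_def split: if_splits)

lemma supported_expand:
  assumes "finite S" "f \<in> supported S"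
  shows "f = (\<Sum>m\<in>S. psc (f m) (xmon m))"
proof
  fix m'
  have "(\<Sum>m\<in>S. psc (f m) (xmon m)) m' = (\<Sum>m\<in>S. psc (f m) (xmon m) m')"
    using assms(1) by (induction S rule: finite_induct) auto
  also have "\<dots> = (\<Sum>m\<in>S. if m' = m then f m else 0)"
    by (intro sum.cong) (auto simp: xmon_def)
  also have "\<dots> = f m'" using assms by (cases m') (auto simp: supported_def)
  finally show "f m' = (\<Sum>m\<in>S. psc (f m) (xmon m)) m'" by simp
qed

lemma inj_xmon: "inj (xmon :: _ \<Rightarrow> 'k::field pol)"
proof (rule injI)
  fix x y :: "nat \<times> nat \<times> nat"
  assume "xmon x = (xmon y :: 'k pol)"
  then have "xmon x x = (xmon y x :: 'k)" by simp
  then show "x = y" by (simp add: xmon_def split: if_splits)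
qed

lemma independent_xmon: "finite S \<Longrightarrow> pol.independent (xmon ` S :: 'k::field pol set)"
proof (rule pol.independent_if_scalars_zero)
  fix g :: "'k pol \<Rightarrow> 'k" and x :: "'k pol"
  assume S: "finite S" and s: "(\<Sum>x\<in>xmon ` S. psc (g x) x) = 0" and "x \<in> xmon ` S"
  then obtain m where m: "m \<in> S" "x = xmon m" by blast
  have "(\<Sum>m\<in>S. psc (g (xmon m)) (xmon m)) = 0"
    using s by (simp add: sum.reindex[OF inj_on_subset[OF inj_xmon]])
  then have "(\<Sum>m\<in>S. psc (g (xmon m)) (xmon m)) m = 0" by simp
  moreover have "(\<Sum>m'\<in>S. psc (g (xmon m')) (xmon m')) m = (\<Sum>m'\<in>S. psc (g (xmon m')) (xmon m') m)"
    using S by (induction S rule: finite_induct) auto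
  moreover have "\<dots> = (\<Sum>m'\<in>S. if m = m' then g (xmon m') else 0)"
    by (intro sum.cong) (auto simp: xmon_def)
  ultimately show "g x = 0" using S m by simp
qed simp

lemma supported_subset_span:
  assumes "finite S"
  shows "supported S \<subseteq> pol.span (xmon ` S :: 'k::field pol set)"
proof
  fix f :: "'k pol" assume "f \<in> supported S"
  then have "f = (\<Sum>m\<in>S. psc (f m) (xmon m))" by (rule supported_expand[OF assms])
  also have "\<dots> \<in> pol.span (xmon ` S)"
    by (intro pol.span_sum pol.span_scale pol.span_base) blast
  finally show "f \<in> pol.span (xmon ` S)" .
qed

lemma dim_supported:
  assumes "finite S"
  shows "pol.dim (supported S :: 'k::field pol set) = card S"
  using pol.dim_unique[OF _ supported_subset_span[OF assms] independent_xmon[OF assms]]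
    card_image[OF inj_on_subset[OF inj_xmon]] xmon_in_supported by blast

lemma fdim_supported: "finite S \<Longrightarrow> pol.fdim (supported S :: 'k::field pol set)"
  unfolding pol.fdim_def using supported_subset_span by blast

lemma supportedD: "f \<in> supported S \<Longrightarrow> f m \<noteq> 0 \<Longrightarrow> m \<in> S"
  by (simp add: supported_def del: split_paired_All)

lemma pmul_xvar_supported:
  assumes f: "f \<in> supported S" and up: "\<And>m. m \<in> S \<Longrightarrow> up i m \<in> S'"
  shows "pmul (xvar i) f \<in> supported S'"
  unfolding supported_def
proof (intro CollectI allI impI)
  fix m assume "pmul (xvar i) f m \<noteq> 0"
  then obtain m' where m: "m = up i m'" "f m' \<noteq> 0" using pmul_xvar_nonzero by blast
  then show "m \<in> S'" unfolding m(1) by (intro up supportedD[OF f])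
qed

lemma supported_subset_polR:
  assumes "finite S"
  shows "supported S \<subseteq> polR"
proof
  fix f :: "'k::field pol" assume "f \<in> supported S"
  then have "{m. f m \<noteq> 0} \<subseteq> S" unfolding supported_def by blast
  then show "f \<in> polR" unfolding polR_def using finite_subset[OF _ assms] by blast
qed

lemmas subspace_Rdeg = subspace_supported[of "monoms t" for t, folded Rdeg_eq_supported]
lemmas fdim_Rdeg = fdim_supported[OF finite_monoms, folded Rdeg_eq_supported]
lemmas dim_Rdeg = dim_supported[OF finite_monoms, folded Rdeg_eq_supported]

lemma Rdeg_subset_polR: "Rdeg t \<subseteq> polR"
  unfolding Rdeg_eq_supported by (rule supported_subset_polR[OF finite_monoms])

text \<open>The number of monomials of degree t whose x_1-exponent is less than b. Truncated
  subtraction kills the terms with l > t, so the value is constant from b = t + 1 on.\<close>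

definition tri :: "nat \<Rightarrow> nat \<Rightarrow> nat" where
  "tri t b = (\<Sum>l<b. Suc t - l)"

lemma card_monoms_fst: "card {m \<in> monoms t. fst m < b} = tri t b"
proof -
  have "{m \<in> monoms t. fst m < b} = (\<Union>l<b. (\<lambda>j. (l, j, t - l - j)) ` {..<Suc t - l})"
    by (force simp: mdeg_def image_iff)
  also have "card \<dots> = (\<Sum>l<b. card ((\<lambda>j. (l, j, t - l - j)) ` {..<Suc t - l}))"
    by (rule card_UN_disjoint) auto
  also have "\<dots> = tri t b"
    unfolding tri_def by (intro sum.cong refl) (simp add: card_image inj_on_def)
  finally show ?thesis .
qed

lemma card_monoms: "card (monoms t) = tri t (Suc t)"
proof -
  have "monoms t = {m \<in> monoms t. fst m < Suc t}" by (auto simp: mdeg_def)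
  then show ?thesis using card_monoms_fst by metis
qed

lemma tri_Suc_Suc: "tri (Suc t) (Suc b) = Suc (Suc t) + tri t b"
  unfolding tri_def by (subst sum.lessThan_Suc_shift) simp

text \<open>Each of the b summands grows by one, as b \<le> t + 1 keeps the subtraction genuine.
  This recursion drives the induction in \<open>hyperplane_restriction\<close>.\<close>

lemma tri_Suc: "b \<le> Suc t \<Longrightarrow> tri (Suc t) b = b + tri t b"
  unfolding tri_def by (induction b) (auto simp: Suc_diff_le)

lemma tri_mono: "b \<le> b' \<Longrightarrow> tri t b \<le> tri t b'"
  unfolding tri_def by (intro sum_mono2) auto

lemma card_monoms_Suc: "card (monoms (Suc t)) = card (monoms t) + Suc (Suc t)"
  by (simp add: card_monoms tri_Suc_Suc)

text \<open>Degree t - 1, but {0} rather than \<^term>\<open>Rdeg 0\<close> for t = 0.\<close>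
definition Rbelow :: "nat \<Rightarrow> 'k::field pol set" where
  "Rbelow t = supported {m. Suc (mdeg m) = t}"

lemma Rbelow_0 [simp]: "Rbelow 0 = {0}"
  by (auto simp: Rbelow_def supported_def)

lemma Rbelow_Suc [simp]: "Rbelow (Suc t) = Rdeg t"
  by (simp add: Rbelow_def Rdeg_eq_supported monoms_def)

lemma subspace_Rbelow: "pol.subspace (Rbelow t)"
  by (simp add: Rbelow_def subspace_supported)

lemma fdim_Rbelow: "pol.fdim (Rbelow t :: 'k::field pol set)"
proof -
  have "{m. Suc (mdeg m) = t} \<subseteq> monoms (t - 1)" by auto
  then show ?thesis
    unfolding Rbelow_def by (intro fdim_supported) (meson finite_monoms finite_subset)
qed

text \<open>Coefficient 1 at x_3 keeps the form nonzero for all parameters and makes a pencil of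
  forms an affine line in the plane of pairs (\<alpha>, \<beta>).\<close>

definition lform :: "'k::field \<Rightarrow> 'k \<Rightarrow> 'k pol \<Rightarrow> 'k pol" where
  "lform \<alpha> \<beta> f = pmul (xvar 2) f - psc \<alpha> (pmul (xvar 0) f) - psc \<beta> (pmul (xvar 1) f)"

lemma linear_lform: "plinear (lform \<alpha> \<beta>)"
  unfolding Vector_Spaces.linear_iff lform_def
  by (auto simp: pol.vector_space_axioms pol.scale_right_distrib pol.scale_right_diff_distrib
      pol.scale_left_commute)

lemmas lform_simps [simp] =
  module_hom.add[OF linear_lform[unfolded module_hom_iff_linear[symmetric]]]
  module_hom.diff[OF linear_lform[unfolded module_hom_iff_linear[symmetric]]]
  module_hom.scale[OF linear_lform[unfolded module_hom_iff_linear[symmetric]]]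
  module_hom.zero[OF linear_lform[unfolded module_hom_iff_linear[symmetric]]]

lemma pmul_xvar_Rbelow: "f \<in> Rbelow t \<Longrightarrow> pmul (xvar i) f \<in> Rdeg t"
  unfolding Rbelow_def Rdeg_eq_supported supported_def using pmul_xvar_nonzero by fastforce

lemma pmul_xvar_Rdeg: "f \<in> Rdeg t \<Longrightarrow> pmul (xvar i) f \<in> Rdeg (Suc t)"
  using pmul_xvar_Rbelow[of f "Suc t"] by simp

lemma lform_Rbelow: "f \<in> Rbelow t \<Longrightarrow> lform \<alpha> \<beta> f \<in> Rdeg t"
  unfolding lform_def
  by (intro pol.subspace_diff pol.subspace_scale subspace_Rdeg pmul_xvar_Rbelow)

lemma lform_commute: "lform \<alpha> \<beta> (pmul (xvar i) f) = pmul (xvar i) (lform \<alpha> \<beta> f)"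
  by (simp add: lform_def pmul_xvar_commute[of i])

lemma lform_lform_commute: "lform \<alpha> \<beta> (lform \<gamma> \<delta> f) = lform \<gamma> \<delta> (lform \<alpha> \<beta> f)"
  by (simp add: lform_def[of \<gamma> \<delta>] lform_commute)

text \<open>The coefficient of the product at (a, b, c + 1) is that of f at (a, b, c) minus
  multiples of coefficients of f with smaller a + b, so induction on a + b applies.\<close>

lemma lform_inj:
  assumes "lform \<alpha> \<beta> f = 0"
  shows "f = 0"
proof -
  have "f (a, b, c) = 0" for a b c
  proof (induction "a + b" arbitrary: a b c rule: less_induct)
    case less
    have "a = 0 \<or> f (a - 1, b, Suc c) = 0" "b = 0 \<or> f (a, b - 1, Suc c) = 0"
      using less[of "a - 1" b "Suc c"] less[of a "b - 1" "Suc c"] by (cases a; cases b; simp)+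
    moreover have "lform \<alpha> \<beta> f (a, b, Suc c) = 0" using assms by simp
    ultimately show ?case by (auto simp: lform_def pmul_xvar_apply split: if_splits)
  qed
  then show ?thesis by (auto simp: fun_eq_iff)
qed

text \<open>The parameters run along the line through (\<alpha>, \<beta>) at c = 0 and (\<gamma>,
  \<delta>) at c = 1; the right-hand side has the shape f + c g of
  \<open>pencil_ssum\<close>.\<close>

lemma lform_pencil:
  "lform (\<alpha> + c * (\<gamma> - \<alpha>)) (\<beta> + c * (\<delta> - \<beta>))
     = (\<lambda>f. lform \<alpha> \<beta> f + psc c (psc (\<alpha> - \<gamma>) (pmul (xvar 0) f) + psc (\<beta> - \<delta>) (pmul (xvar 1) f)))"
  by (auto simp: lform_def fun_eq_iff algebra_simps)

section \<open>Hyperplane restriction\<close>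

lemma ssum_Rdeg_subset:
  assumes "V \<subseteq> Rdeg t"
  shows "ssum V (lform \<alpha> \<beta> ` Rbelow t) \<subseteq> Rdeg t"
  using assms lform_Rbelow by (intro pol.ssum_subset subspace_Rdeg) auto

lemma subspace_lform_Rbelow: "pol.subspace (lform \<alpha> \<beta> ` Rbelow t)"
proof -
  interpret l: Vector_Spaces.linear psc psc "lform \<alpha> \<beta>" by (rule linear_lform)
  show ?thesis by (rule l.subspace_image[OF subspace_Rbelow])
qed

lemma fdim_lform_Rbelow: "pol.fdim (lform \<alpha> \<beta> ` Rbelow t)"
  by (rule polpol.fdim_image[OF linear_lform fdim_Rbelow])

text \<open>For dimension reasons W contains a nonzero form in x_1, x_2. The new linear form is the old one
  minus x_1 - c x_2, where c is chosen such that the form does not vanish at x_1 = c, x_2 = 1.\<close>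
lemma exists_complementary_lform:
  fixes W :: "'k::field_char_0 pol set"
  assumes W: "pol.subspace W" "W \<subseteq> Rdeg t" and L: "lform \<alpha> \<beta> ` Rbelow t \<subseteq> W"
    and codim: "card (monoms t) \<le> pol.dim W + t"
  obtains \<gamma> \<delta> where "ssum W (lform \<gamma> \<delta> ` Rbelow t) = Rdeg t"
proof -
  define e where "e = (\<lambda>i. (i, t - i, 0::nat))"
  define E where "E = (supported (e ` {..t}) :: 'k pol set)"
  have injE: "inj_on e {..t}" by (auto simp: e_def inj_on_def)
  have dimE: "pol.dim E = Suc t"
    by (simp add: E_def dim_supported card_image[OF injE])
  have "mdeg (e i) = t" if "i \<le> t" for i using that by (simp add: e_def mdeg_def)
  then have E: "pol.subspace E" "pol.fdim E" "E \<subseteq> Rdeg t"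
    unfolding E_def Rdeg_eq_supported
    by (simp_all add: subspace_supported fdim_supported) (force simp: supported_def)
  have fW: "pol.fdim W" using pol.fdim_mono[OF fdim_Rdeg W(2)] .
  \<comment> \<open>The forms \<open>E\<close> in x_1 and x_2 have dimension t + 1 and W has
    codimension at most t, so they meet nontrivially.\<close>
  have "pol.dim (ssum W E) + pol.dim {u \<in> E. u \<in> W} = pol.dim W + Suc t"
    using pol.dim_ssum_image[OF W(1) fW E(1,2) pol.linear_ident] dimE by simp
  moreover have "pol.dim (ssum W E) \<le> card (monoms t)"
    using pol.dim_mono_fdim[OF pol.ssum_subset[OF subspace_Rdeg W(2) E(3)] fdim_Rdeg] dim_Rdeg
    by metis
  ultimately have "pol.dim {u \<in> E. u \<in> W} \<noteq> 0" using codim by linarith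
  moreover have "pol.dim {u \<in> E. u \<in> W} = 0" if "{u \<in> E. u \<in> W} \<subseteq> {0}"
    using pol.dim_le_card[of "{u \<in> E. u \<in> W}" "{}"] that by simp
  ultimately have "\<not> {u \<in> E. u \<in> W} \<subseteq> {0}" by argo
  then obtain f where f: "f \<in> E" "f \<in> W" "f \<noteq> 0" by blast
  \<comment> \<open>This is f with x_2 = 1, as a polynomial in x_1; as f involves no x_3, it is
    nonzero.\<close>
  define p where "p = (\<Sum>i\<le>t. monom (f (e i)) i)"
  have coeff_p: "coeff p i = f (e i)" if "i \<le> t" for i
    using that by (simp add: p_def coeff_sum)
  obtain m where "f m \<noteq> 0" using f(3) by (metis ext zero_fun_apply)
  then obtain i where "i \<le> t" "f (e i) \<noteq> 0" using f(1) unfolding E_def supported_def by blast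
  then have "p \<noteq> 0" using coeff_p[of i] by auto
  then have "finite {c. poly p c = 0}" by (rule poly_roots_finite)
  then obtain c where c: "poly p c \<noteq> 0"
    using infinite_UNIV_char_0[where 'a = 'k] by (metis (mono_tags) UNIV_eq_I mem_Collect_eq)
  define \<gamma> \<delta> where "\<gamma> = \<alpha> + 1" and "\<delta> = \<beta> - c"
  define U where "U = ssum W (lform \<gamma> \<delta> ` Rbelow t)"
  have U: "pol.subspace U"
    unfolding U_def by (rule pol.subspace_ssum[OF W(1) subspace_lform_Rbelow])
  have WU: "W \<subseteq> U" "lform \<gamma> \<delta> ` Rbelow t \<subseteq> U"
    unfolding U_def
    by (rule pol.ssum_upper(1)[OF subspace_lform_Rbelow], rule pol.ssum_upper(2)[OF W(1)])
  have LU: "lform \<alpha> \<beta> g \<in> U" "lform \<gamma> \<delta> g \<in> U" if "g \<in> Rbelow t" for g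
    using L WU that by auto
  \<comment> \<open>The difference of the two linear forms is x_1 - c x_2. So modulo
    \<open>U\<close> multiplication by x_1 acts as c x_2, and then x_3 acts as s x_2 with s =
    \<alpha> c + \<beta>.\<close>
  have X0: "pmul (xvar 0) g - psc c (pmul (xvar 1) g) \<in> U" if "g \<in> Rbelow t" for g
  proof -
    have "lform \<alpha> \<beta> g - lform \<gamma> \<delta> g \<in> U" using LU[OF that] U by (rule_tac pol.subspace_diff)
    also have "lform \<alpha> \<beta> g - lform \<gamma> \<delta> g = pmul (xvar 0) g - psc c (pmul (xvar 1) g)"
      by (auto simp: lform_def \<gamma>_def \<delta>_def fun_eq_iff algebra_simps)
    finally show ?thesis .
  qed
  define s where "s = \<alpha> * c + \<beta>"
  have X2: "pmul (xvar 2) g - psc s (pmul (xvar 1) g) \<in> U" if "g \<in> Rbelow t" for g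
  proof -
    have "lform \<alpha> \<beta> g + psc \<alpha> (pmul (xvar 0) g - psc c (pmul (xvar 1) g)) \<in> U"
      using LU(1)[OF that] X0[OF that] U by (intro pol.subspace_add pol.subspace_scale)
    also have "lform \<alpha> \<beta> g + psc \<alpha> (pmul (xvar 0) g - psc c (pmul (xvar 1) g))
        = pmul (xvar 2) g - psc s (pmul (xvar 1) g)"
      by (auto simp: lform_def s_def fun_eq_iff algebra_simps)
    finally show ?thesis .
  qed
  have below: "xmon m \<in> (Rbelow t :: 'k pol set)" if "Suc (mdeg m) = t" for m
    unfolding Rbelow_def using that by (intro xmon_in_supported) simp
  \<comment> \<open>Modulo \<open>U\<close> each monomial of degree t is thus a multiple of x_2^t.
    In particular f becomes p(c) x_2^t, which puts x_2^t and then every monomial of degree t into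
    \<open>U\<close>.\<close>
  have red: "xmon (a, b, d) - psc (c ^ a * s ^ d) (xmon (0, t, 0)) \<in> U" if "a + b + d = t" for a b d
    using that
  proof (induction "a + d" arbitrary: a b d)
    case 0
    then show ?case using pol.subspace_0[OF U] by (auto simp: psc_def fun_eq_iff zero_fun_def)
  next
    case (Suc n)
    show ?case
    proof (cases a)
      case (Suc a')
      have "xmon (a, b, d) - psc c (xmon (a', Suc b, d)) \<in> U"
        using X0[OF below[of "(a', b, d)"]] Suc.prems
        by (simp add: pmul_xvar_xmon Suc mdeg_def) (simp add: up_def)
      moreover have "xmon (a', Suc b, d) - psc (c ^ a' * s ^ d) (xmon (0, t, 0)) \<in> U"
        using Suc.hyps Suc.prems Suc by (intro Suc.hyps(1)) auto
      ultimately have "(xmon (a, b, d) - psc c (xmon (a', Suc b, d)))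
          + psc c (xmon (a', Suc b, d) - psc (c ^ a' * s ^ d) (xmon (0, t, 0))) \<in> U" (is "?x \<in> U")
        using U by (intro pol.subspace_add pol.subspace_scale)
      also have "?x = xmon (a, b, d) - psc (c ^ a * s ^ d) (xmon (0, t, 0))"
        by (auto simp: fun_eq_iff Suc algebra_simps)
      finally show ?thesis .
    next
      case 0
      then obtain d' where d': "d = Suc d'" using Suc.hyps(2) by (cases d) auto
      have "xmon (a, b, d) - psc s (xmon (a, Suc b, d')) \<in> U"
        using X2[OF below[of "(a, b, d')"]] Suc.prems
        by (simp add: pmul_xvar_xmon d' mdeg_def) (simp add: up_def)
      moreover have "xmon (a, Suc b, d') - psc (c ^ a * s ^ d') (xmon (0, t, 0)) \<in> U"
        using Suc.hyps Suc.prems d' by (intro Suc.hyps(1)) auto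
      ultimately have "(xmon (a, b, d) - psc s (xmon (a, Suc b, d')))
          + psc s (xmon (a, Suc b, d') - psc (c ^ a * s ^ d') (xmon (0, t, 0))) \<in> U" (is "?x \<in> U")
        using U by (intro pol.subspace_add pol.subspace_scale)
      also have "?x = xmon (a, b, d) - psc (c ^ a * s ^ d) (xmon (0, t, 0))"
        by (auto simp: fun_eq_iff d' algebra_simps)
      finally show ?thesis .
    qed
  qed
  have f_eq: "f = (\<Sum>i\<le>t. psc (f (e i)) (xmon (e i)))"
    using supported_expand[of "e ` {..t}" f] f(1) by (simp add: E_def sum.reindex[OF injE])
  have "(\<Sum>i\<le>t. psc (f (e i)) (xmon (e i) - psc (c ^ i) (xmon (0, t, 0)))) \<in> U"
    using U red[of _ _ 0] by (intro pol.subspace_sum pol.subspace_scale) (auto simp: e_def)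
  also have "(\<Sum>i\<le>t. psc (f (e i)) (xmon (e i) - psc (c ^ i) (xmon (0, t, 0))))
      = f - psc (poly p c) (xmon (0, t, 0))"
    by (subst f_eq) (simp add: pol.scale_right_diff_distrib sum_subtractf p_def poly_sum poly_monom
        pol.scale_sum_left)
  finally have "f - (f - psc (poly p c) (xmon (0, t, 0))) \<in> U"
    by (rule pol.subspace_diff[OF U subsetD[OF WU(1) f(2)]])
  then have "psc (poly p c) (xmon (0, t, 0)) \<in> U" by (simp del: psc_apply)
  then have "psc (1 / poly p c) (psc (poly p c) (xmon (0, t, 0))) \<in> U"
    by (rule pol.subspace_scale[OF U])
  then have last: "xmon (0, t, 0) \<in> U" using c by simp
  have all: "xmon m \<in> U" if "mdeg m = t" for m
  proof -
    obtain a b d where m: "m = (a, b, d)" by (cases m)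
    have "(xmon m - psc (c ^ a * s ^ d) (xmon (0, t, 0))) + psc (c ^ a * s ^ d) (xmon (0, t, 0)) \<in> U"
      using that m last red[of a b d] U by (intro pol.subspace_add pol.subspace_scale) (auto simp: mdeg_def)
    then show ?thesis by simp
  qed
  have "Rdeg t \<subseteq> U"
  proof
    fix g :: "'k pol" assume "g \<in> Rdeg t"
    then have "g = (\<Sum>m\<in>monoms t. psc (g m) (xmon m))"
      unfolding Rdeg_eq_supported by (intro supported_expand) auto
    also have "\<dots> \<in> U" using all U by (intro pol.subspace_sum pol.subspace_scale) auto
    finally show "g \<in> U" .
  qed
  then have "U = Rdeg t" using ssum_Rdeg_subset[OF W(2)] unfolding U_def by blast
  then show thesis using that unfolding U_def by blast
qed

section \<open>Evaluation of forms at points\<close>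

lemma sum_pmul_xvar:
  "(\<Sum>m\<in>monoms (Suc t). pmul (xvar i) g m * w m) = (\<Sum>m\<in>monoms t. g m * w (up i m))"
proof -
  have "(\<Sum>m\<in>monoms (Suc t). pmul (xvar i) g m * w m)
      = (\<Sum>m\<in>up i ` monoms t. pmul (xvar i) g m * w m)"
  proof (rule sum.mono_neutral_right)
    show "\<forall>m\<in>monoms (Suc t) - up i ` monoms t. pmul (xvar i) g m * w m = 0"
    proof
      fix m assume m: "m \<in> monoms (Suc t) - up i ` monoms t"
      have "pmul (xvar i) g m = 0"
      proof (rule ccontr)
        assume "pmul (xvar i) g m \<noteq> 0"
        then obtain m' where "m = up i m'" using pmul_xvar_nonzero by blast
        then show False using m by auto
      qed
      then show "pmul (xvar i) g m * w m = 0" by simp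
    qed
  qed auto
  then show ?thesis by (simp add: sum.reindex[OF inj_on_subset[OF inj_up]])
qed

text \<open>The sums are the values of a univariate polynomial, which vanishes on an infinite field
  and hence is zero; its coefficient at a collects the terms with k m = a.\<close>

lemma coeffs_zero_if_sum_powers_zero:
  fixes x :: "'a \<Rightarrow> 'k::field_char_0"
  assumes "\<And>u. (\<Sum>m\<in>D. x m * u ^ k m) = 0"
  shows "(\<Sum>m\<in>D. if k m = a then x m else 0) = 0"
proof -
  define p where "p = (\<Sum>m\<in>D. monom (x m) (k m))"
  have "poly p u = 0" for u using assms[of u] by (simp add: p_def poly_sum poly_monom)
  then have "p = 0" using poly_all_0_iff_0 by blast
  then have "coeff p a = 0" by simp
  then show ?thesis by (simp add: p_def coeff_sum)
qed

text \<open>A form divisible by x_3 - v x_2 vanishes at all points (u, 1, v). If this holds for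
  every v, the polynomial f(u, 1, v) is identically zero, and with it the form f.\<close>

lemma zero_if_in_all_lform_images:
  fixes f :: "'k::field_char_0 pol"
  assumes f: "f \<in> Rdeg t" and all: "\<And>\<beta>. f \<in> lform 0 \<beta> ` Rbelow t"
  shows "f = 0"
proof (cases t)
  case 0
  then show ?thesis using all[of 0] by auto
next
  case (Suc t')
  define e where "e = (\<lambda>m :: nat \<times> nat \<times> nat. snd (snd m))"
  have ev: "(\<Sum>m\<in>monoms t. f m * (u ^ fst m * v ^ e m)) = 0" for u v
  proof -
    obtain g where g: "f = lform 0 v g" using all[of v] by blast
    let ?w = "\<lambda>m. u ^ fst m * v ^ e m"
    have "(\<Sum>m\<in>monoms t. f m * ?w m)
        = (\<Sum>m\<in>monoms t. pmul (xvar 2) g m * ?w m) - v * (\<Sum>m\<in>monoms t. pmul (xvar 1) g m * ?w m)"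
      by (simp add: g lform_def algebra_simps sum_subtractf sum_distrib_left)
    also have "\<dots> = (\<Sum>m\<in>monoms t'. g m * ?w (up 2 m)) - v * (\<Sum>m\<in>monoms t'. g m * ?w (up 1 m))"
      unfolding Suc sum_pmul_xvar ..
    also have "(\<Sum>m\<in>monoms t'. g m * ?w (up 2 m)) = v * (\<Sum>m\<in>monoms t'. g m * ?w (up 1 m))"
      unfolding sum_distrib_left
      by (intro sum.cong) (auto simp: up_def e_def split: prod.splits)
    finally show ?thesis by simp
  qed
  show ?thesis
  proof (rule ext)
    fix m0 :: "nat \<times> nat \<times> nat"
    show "f m0 = 0 m0"
    proof (cases "m0 \<in> monoms t")
      case False
      then show ?thesis using f by (cases m0) (auto simp: Rdeg_eq_supported supported_def)
    next
      case True
      \<comment> \<open>Coefficients are compared first in u, then in v; in degree t the exponents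
        of x_1 and x_3 determine the monomial.\<close>
      have "(\<Sum>m\<in>monoms t. if fst m = fst m0 then f m * v ^ e m else 0) = 0" for v
        using ev by (intro coeffs_zero_if_sum_powers_zero) (simp add: mult_ac)
      then have "(\<Sum>m\<in>monoms t. (if fst m = fst m0 then f m else 0) * v ^ e m) = 0" for v
        by (simp add: if_distrib[of "\<lambda>x. x * _"] cong: if_cong)
      then have "(\<Sum>m\<in>monoms t. if e m = e m0 then (if fst m = fst m0 then f m else 0) else 0) = 0"
        by (rule coeffs_zero_if_sum_powers_zero)
      moreover have "(\<Sum>m\<in>monoms t. if e m = e m0 then (if fst m = fst m0 then f m else 0) else 0)
          = (\<Sum>m\<in>monoms t. if m = m0 then f m else 0)"
        using True by (intro sum.cong; cases m0) (auto simp: e_def mdeg_def)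
      ultimately show ?thesis using True by simp
    qed
  qed
qed

lemma pencil_lform:
  assumes V: "pol.subspace V" "pol.fdim V" and U: "pol.subspace U" "pol.fdim U"
  shows "finite {c. pol.dim (ssum V (lform (\<alpha> + c * (\<gamma> - \<alpha>)) (\<beta> + c * (\<delta> - \<beta>)) ` U))
                 < pol.dim (ssum V (lform \<alpha> \<beta> ` U))}"
proof -
  have "plinear (\<lambda>f. psc (\<alpha> - \<gamma>) (pmul (xvar 0) f) + psc (\<beta> - \<delta>) (pmul (xvar 1) f))"
    unfolding Vector_Spaces.linear_iff
    by (auto simp: pol.vector_space_axioms pol.scale_right_distrib pol.scale_left_commute)
  from pol.pencil_ssum[OF V U linear_lform[of \<alpha> \<beta>] this] show ?thesis
    by (simp only: lform_pencil)
qed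

text \<open>On the line joining the two parameter pairs each inequality fails at finitely many
  points only. The second pencil runs along the same line from the other end, hence the substitution
  of 1 - c for c.\<close>

lemma common_pencil_lform:
  fixes V W :: "'k::field_char_0 pol set"
  assumes "pol.subspace V" "pol.fdim V" "pol.subspace W" "pol.fdim W"
    and "pol.subspace U" "pol.fdim U" "pol.subspace U'" "pol.fdim U'"
  obtains \<gamma> \<delta> where
    "pol.dim (ssum V (lform \<gamma>\<^sub>1 \<delta>\<^sub>1 ` U)) \<le> pol.dim (ssum V (lform \<gamma> \<delta> ` U))"
    "pol.dim (ssum W (lform \<gamma>\<^sub>2 \<delta>\<^sub>2 ` U')) \<le> pol.dim (ssum W (lform \<gamma> \<delta> ` U'))"
proof -
  define A where "A = {c. pol.dim (ssum V (lform (\<gamma>\<^sub>1 + c * (\<gamma>\<^sub>2 - \<gamma>\<^sub>1)) (\<delta>\<^sub>1 + c * (\<delta>\<^sub>2 - \<delta>\<^sub>1)) ` U))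
                 < pol.dim (ssum V (lform \<gamma>\<^sub>1 \<delta>\<^sub>1 ` U))}"
  define B where "B = {c. pol.dim (ssum W (lform (\<gamma>\<^sub>2 + c * (\<gamma>\<^sub>1 - \<gamma>\<^sub>2)) (\<delta>\<^sub>2 + c * (\<delta>\<^sub>1 - \<delta>\<^sub>2)) ` U'))
                 < pol.dim (ssum W (lform \<gamma>\<^sub>2 \<delta>\<^sub>2 ` U'))}"
  have "finite A" "finite B"
    unfolding A_def B_def
    by (rule pencil_lform[OF assms(1,2,5,6)], rule pencil_lform[OF assms(3,4,7,8)])
  then have "finite (A \<union> (\<lambda>c. 1 - c) ` B)" by simp
  then obtain c where c: "c \<notin> A" "c \<notin> (\<lambda>c. 1 - c) ` B"
    using infinite_UNIV_char_0[where 'a = 'k] by (metis UNIV_eq_I UnCI)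
  have "1 - c \<notin> B" using c(2) by (metis diff_diff_eq2 add_diff_cancel_left' image_eqI)
  moreover have "\<gamma>\<^sub>2 + (1 - c) * (\<gamma>\<^sub>1 - \<gamma>\<^sub>2) = \<gamma>\<^sub>1 + c * (\<gamma>\<^sub>2 - \<gamma>\<^sub>1)"
    "\<delta>\<^sub>2 + (1 - c) * (\<delta>\<^sub>1 - \<delta>\<^sub>2) = \<delta>\<^sub>1 + c * (\<delta>\<^sub>2 - \<delta>\<^sub>1)" by (simp_all add: algebra_simps)
  ultimately show thesis using that c(1) unfolding A_def B_def by (simp add: not_less)
qed

text \<open>Green's argument: L is chosen with V + L R of maximal dimension. For a form H generic with respect to
  both the colon space V' = (V : L) and V + L R, the space (V + H R : L) contains V' + H R,
  so the maximality of L bounds the codimension of the restriction of V' from below.\<close>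
lemma hyperplane_restriction:
  fixes V :: "'k::field_char_0 pol set"
  assumes "pol.subspace V" "V \<subseteq> Rdeg t"
  shows "\<exists>\<alpha> \<beta>. tri t (card (monoms t) - pol.dim (ssum V (lform \<alpha> \<beta> ` Rbelow t)))
              \<le> card (monoms t) - pol.dim V"
  using assms
proof (induction t arbitrary: V)
  case 0
  have "ssum V (lform 0 0 ` Rbelow 0) = V"
    by (auto simp: ssum_def)
  moreover have "tri 0 b \<le> b" for b by (induction b) (auto simp: tri_def)
  ultimately show ?case by metis
next
  case (Suc t')
  define t where "t = Suc t'"
  define r r' where "r = card (monoms t)" and "r' = card (monoms t')"
  have r: "r = r' + Suc t" by (simp add: r_def r'_def t_def card_monoms_Suc)
  have V: "pol.subspace V" "V \<subseteq> Rdeg t" using Suc.prems by (simp_all only: t_def)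
  have fV: "pol.fdim V" using pol.fdim_mono[OF fdim_Rdeg V(2)] .
  have Rt: "Rbelow t = Rdeg t'" by (simp add: t_def)
  note dim_ssum = pol.dim_ssum_image[OF _ _ subspace_Rdeg fdim_Rdeg linear_lform]
  define cod where "cod = (\<lambda>(\<alpha>, \<beta>). r - pol.dim (ssum V (lform \<alpha> \<beta> ` Rdeg t')))"
  \<comment> \<open>Codimensions are natural numbers, so a form with the least one exists; it takes
    the place of a generic form.\<close>
  obtain \<alpha> \<beta> where min: "\<And>\<gamma> \<delta>. cod (\<alpha>, \<beta>) \<le> cod (\<gamma>, \<delta>)"
    using ex_has_least_nat[of "\<lambda>_. True" _ cod] by (metis surj_pair)
  define b where "b = cod (\<alpha>, \<beta>)"
  have le_r: "pol.dim X \<le> r" if "X \<subseteq> Rdeg t" for X :: "'k pol set"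
    using pol.dim_mono_fdim[OF that fdim_Rdeg] dim_Rdeg[of t, where 'k = 'k] by (simp add: r_def)
  have dimR: "pol.dim (Rdeg t' :: 'k pol set) = r'" by (simp add: dim_Rdeg r'_def)
  have dimL: "pol.dim (lform \<gamma> \<delta> ` Rdeg t' :: 'k pol set) = r'" for \<gamma> \<delta>
    using polpol.dim_image_inj[OF linear_lform subspace_Rdeg fdim_Rdeg] lform_inj dimR by metis
  have Lsub: "pol.subspace (lform \<gamma> \<delta> ` Rdeg t' :: 'k pol set)"
    "pol.fdim (lform \<gamma> \<delta> ` Rdeg t' :: 'k pol set)" for \<gamma> \<delta>
    using subspace_lform_Rbelow[of _ _ t] fdim_lform_Rbelow[of _ _ t] Rt by metis+
  have S: "pol.subspace (ssum V (lform \<gamma> \<delta> ` Rdeg t'))" "ssum V (lform \<gamma> \<delta> ` Rdeg t') \<subseteq> Rdeg t"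
    "pol.fdim (ssum V (lform \<gamma> \<delta> ` Rdeg t'))" for \<gamma> \<delta>
    using pol.subspace_ssum[OF V(1) Lsub(1)] ssum_Rdeg_subset[OF V(2)] pol.fdim_ssum[OF fV Lsub(2)]
    by (auto simp: Rt)
  have L_le: "lform \<gamma> \<delta> ` Rdeg t' \<subseteq> ssum V (lform \<gamma> \<delta> ` Rdeg t')" for \<gamma> \<delta>
    by (rule pol.ssum_upper(2)[OF V(1)])
  have "r' \<le> pol.dim (ssum V (lform \<alpha> \<beta> ` Rdeg t'))"
    using pol.dim_mono_fdim[OF L_le S(3)] dimL by metis
  then have b_le: "b \<le> Suc t" using r by (simp add: b_def cod_def)
  have "tri t b \<le> r - pol.dim V"
  proof (cases "b = Suc t")
    case True
    \<comment> \<open>Here even the best form leaves codimension t + 1, the codimension of L R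
      itself. So V lies in L R for every L and must be zero.\<close>
    have V_le: "V \<subseteq> lform \<gamma> \<delta> ` Rdeg t'" for \<gamma> \<delta>
    proof -
      have "pol.dim (ssum V (lform \<gamma> \<delta> ` Rdeg t')) \<le> pol.dim (lform \<gamma> \<delta> ` Rdeg t')"
        using min[of \<gamma> \<delta>] True le_r[OF S(2)[of \<gamma> \<delta>]] r unfolding dimL b_def
        by (simp add: cod_def)
      then have "lform \<gamma> \<delta> ` Rdeg t' = ssum V (lform \<gamma> \<delta> ` Rdeg t')"
        by (rule pol.subspace_eqI_dim[OF Lsub(1) L_le S(3)])
      then show ?thesis using pol.ssum_upper(1)[OF Lsub(1)] by blast
    qed
    then have "V \<subseteq> {0}"
      using zero_if_in_all_lform_images[of _ t] V(2) unfolding Rt by blast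
    then have "pol.dim V = 0" using pol.dim_le_card[of V "{}"] by simp
    then show ?thesis by (simp add: True r_def card_monoms)
  next
    case False
    then have b: "b \<le> t" using b_le by simp
    define V' where "V' = {g \<in> Rdeg t'. lform \<alpha> \<beta> g \<in> V}"
    define W where "W = ssum V (lform \<alpha> \<beta> ` Rdeg t')"
    have V': "V' \<subseteq> Rdeg t'" "pol.subspace V'"
    proof -
      interpret l: Vector_Spaces.linear psc psc "lform \<alpha> \<beta>" by (rule linear_lform)
      have "V' = Rdeg t' \<inter> {g. lform \<alpha> \<beta> g \<in> V}" by (auto simp: V'_def)
      then show "pol.subspace V'"
        using pol.subspace_inter[OF subspace_Rdeg l.subspace_linear_preimage[OF V(1)]] by simp
    qed (auto simp: V'_def)
    have fV': "pol.fdim V'" using pol.fdim_mono[OF fdim_Rdeg V'(1)] .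
    have dimW: "pol.dim W + b = r" using le_r[OF S(2)[of \<alpha> \<beta>]] by (simp add: W_def b_def cod_def)
    have dimV': "r + pol.dim V' = pol.dim V + r' + b"
      using dim_ssum[OF V(1) fV, of \<alpha> \<beta> t'] dimW dimR by (simp add: W_def V'_def)
    \<comment> \<open>One form suits the colon space \<open>V'\<close> by induction, another
      complements \<open>W\<close>, which requires b \<le> t. A form H on the line joining them
      serves both purposes.\<close>
    obtain \<gamma>\<^sub>1 \<delta>\<^sub>1 where g1: "tri t' (r' - pol.dim (ssum V' (lform \<gamma>\<^sub>1 \<delta>\<^sub>1 ` Rbelow t'))) \<le> r' - pol.dim V'"
      using Suc.IH[OF V'(2,1)] unfolding r'_def by blast
    obtain \<gamma>\<^sub>2 \<delta>\<^sub>2 where g2: "ssum W (lform \<gamma>\<^sub>2 \<delta>\<^sub>2 ` Rdeg t') = Rdeg t"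
    proof (rule exists_complementary_lform[of W t \<alpha> \<beta>, unfolded Rt])
      show "card (monoms t) \<le> pol.dim W + t" using dimW b by (simp add: r_def)
    qed (auto simp: W_def S L_le that)
    obtain \<gamma> \<delta> where
      h1: "pol.dim (ssum V' (lform \<gamma>\<^sub>1 \<delta>\<^sub>1 ` Rbelow t')) \<le> pol.dim (ssum V' (lform \<gamma> \<delta> ` Rbelow t'))" and
      h2: "pol.dim (ssum W (lform \<gamma>\<^sub>2 \<delta>\<^sub>2 ` Rdeg t')) \<le> pol.dim (ssum W (lform \<gamma> \<delta> ` Rdeg t'))"
      by (rule common_pencil_lform[of V' W "Rbelow t'" "Rdeg t'"])
        (simp_all add: V' fV' W_def S subspace_Rbelow fdim_Rbelow subspace_Rdeg fdim_Rdeg)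
    define U where "U = ssum V (lform \<gamma> \<delta> ` Rdeg t')"
    have U: "pol.subspace U" "pol.fdim U" "U \<subseteq> Rdeg t" by (auto simp: U_def S)
    have dimU: "pol.dim U + b \<le> r"
      using min[of \<gamma> \<delta>] le_r[OF U(3)] dimW by (simp add: U_def b_def cod_def)
    \<comment> \<open>As V + L R + H R is all of degree t, so is \<open>U\<close> + L R. With the
      minimality of b this bounds the dimension of the colon space of \<open>U\<close> by r' -
      b.\<close>
    have "ssum W (lform \<gamma> \<delta> ` Rdeg t') \<subseteq> ssum U (lform \<alpha> \<beta> ` Rdeg t')"
    proof
      fix x assume "x \<in> ssum W (lform \<gamma> \<delta> ` Rdeg t')"
      then obtain v g h where x: "v \<in> V" "g \<in> Rdeg t'" "h \<in> Rdeg t'"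
        "x = (v + lform \<alpha> \<beta> g) + lform \<gamma> \<delta> h" by (auto simp: W_def ssum_def)
      then have "x = (v + lform \<gamma> \<delta> h) + lform \<alpha> \<beta> g" by (simp add: algebra_simps)
      then show "x \<in> ssum U (lform \<alpha> \<beta> ` Rdeg t')" using x(1-3) unfolding U_def ssum_def by blast
    qed
    then have "pol.dim (ssum W (lform \<gamma> \<delta> ` Rdeg t')) \<le> pol.dim (ssum U (lform \<alpha> \<beta> ` Rdeg t'))"
      by (rule pol.dim_mono_fdim[OF _ pol.fdim_ssum[OF U(2) Lsub(2)]])
    then have "r \<le> pol.dim (ssum U (lform \<alpha> \<beta> ` Rdeg t'))"
      using h2 unfolding g2 dim_Rdeg r_def by (rule le_trans[rotated])
    moreover have "pol.dim (ssum U (lform \<alpha> \<beta> ` Rdeg t')) + pol.dim {g \<in> Rdeg t'. lform \<alpha> \<beta> g \<in> U}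
        = pol.dim U + r'"
      using dim_ssum[OF U(1,2), of \<alpha> \<beta> t'] unfolding dimR .
    moreover have "pol.dim (ssum V' (lform \<gamma> \<delta> ` Rbelow t')) \<le> pol.dim {g \<in> Rdeg t'. lform \<alpha> \<beta> g \<in> U}"
    proof (rule pol.dim_mono_fdim)
      show "pol.fdim {g \<in> Rdeg t'. lform \<alpha> \<beta> g \<in> U}"
        by (rule pol.fdim_mono[OF fdim_Rdeg]) auto
      show "ssum V' (lform \<gamma> \<delta> ` Rbelow t') \<subseteq> {g \<in> Rdeg t'. lform \<alpha> \<beta> g \<in> U}"
      proof
        fix x assume "x \<in> ssum V' (lform \<gamma> \<delta> ` Rbelow t')"
        then obtain v g where x: "v \<in> V'" "g \<in> Rbelow t'" "x = v + lform \<gamma> \<delta> g"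
          by (auto simp: ssum_def)
        have "lform \<alpha> \<beta> x = lform \<alpha> \<beta> v + lform \<gamma> \<delta> (lform \<alpha> \<beta> g)"
          by (simp add: x(3) lform_lform_commute[of \<alpha>])
        moreover have "lform \<alpha> \<beta> v \<in> V" "lform \<alpha> \<beta> g \<in> Rdeg t'"
          using x lform_Rbelow by (auto simp: V'_def)
        ultimately have "lform \<alpha> \<beta> x \<in> U" unfolding U_def ssum_def by blast
        moreover have "x \<in> Rdeg t'"
          using x V'(1) lform_Rbelow pol.subspace_add[OF subspace_Rdeg] by blast
        ultimately show "x \<in> {g \<in> Rdeg t'. lform \<alpha> \<beta> g \<in> U}" by blast
      qed
    qed
    \<comment> \<open>The colon space of \<open>U\<close> contains \<open>V'\<close> + H R, so the
      latter has codimension at least b. The codimension of V exceeds that of \<open>V'\<close> by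
      b, which matches the recursion of \<open>tri\<close>.\<close>
    ultimately have "b \<le> r' - pol.dim (ssum V' (lform \<gamma>\<^sub>1 \<delta>\<^sub>1 ` Rbelow t'))"
      using h1 dimU by linarith
    then have "tri t' b \<le> r' - pol.dim V'" using g1 tri_mono le_trans by blast
    moreover have "tri t b = b + tri t' b" unfolding t_def using b by (intro tri_Suc) (simp add: t_def)
    moreover have "pol.dim V' \<le> r'"
      using pol.dim_mono_fdim[OF V'(1) fdim_Rdeg] unfolding dimR .
    ultimately show ?thesis using dimV' by linarith
  qed
  then show ?case unfolding b_def cod_def r_def t_def prod.case Rbelow_Suc by blast
qed

section \<open>Koszul homology\<close>

interpretation chn: fd_space "csc :: 'k::field \<Rightarrow> (nat set \<Rightarrow> 'k pol) \<Rightarrow> nat set \<Rightarrow> 'k pol"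
  by unfold_locales (auto simp: csc_def fun_eq_iff algebra_simps)

interpretation chnchn: fd_space_pair "csc :: 'k::field \<Rightarrow> (nat set \<Rightarrow> 'k pol) \<Rightarrow> nat set \<Rightarrow> 'k pol" csc ..
interpretation polchn: fd_space_pair "psc :: 'k::field \<Rightarrow> 'k pol \<Rightarrow> 'k pol" csc ..
interpretation chnpol: fd_space_pair "csc :: 'k::field \<Rightarrow> (nat set \<Rightarrow> 'k pol) \<Rightarrow> nat set \<Rightarrow> 'k pol" psc ..

lemma csc_eq: "csc c F = (\<lambda>S. psc c (F S))"
  by (simp add: csc_def psc_def)

section \<open>Koszul chains as families of polynomials\<close>

definition families :: "nat set set \<Rightarrow> 'k::field pol set \<Rightarrow> (nat set \<Rightarrow> 'k pol) set" where
  "families C V = {F. (\<forall>S. F S \<in> V) \<and> (\<forall>S. S \<notin> C \<longrightarrow> F S = 0)}"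

definition single :: "nat set \<Rightarrow> 'k::field pol \<Rightarrow> nat set \<Rightarrow> 'k pol" where
  "single S f = (\<lambda>S'. if S' = S then f else 0)"

lemma linear_single: "Vector_Spaces.linear psc csc (single S)"
  unfolding Vector_Spaces.linear_iff
  by (auto simp: pol.vector_space_axioms chn.vector_space_axioms single_def csc_eq fun_eq_iff)

lemma linear_eval: "Vector_Spaces.linear csc psc (\<lambda>F. F S)"
  unfolding Vector_Spaces.linear_iff
  by (auto simp: pol.vector_space_axioms chn.vector_space_axioms csc_eq)

lemma subspace_families:
  assumes "pol.subspace V"
  shows "chn.subspace (families C V)"
proof (rule chn.subspaceI)
  show "0 \<in> families C V" using pol.subspace_0[OF assms] by (simp add: families_def)
  show "F + G \<in> families C V" if "F \<in> families C V" "G \<in> families C V" for F G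
    using that pol.subspace_add[OF assms] by (simp add: families_def)
  show "csc c F \<in> families C V" if "F \<in> families C V" for c F
    using that pol.subspace_scale[OF assms] by (simp add: families_def csc_eq del: psc_apply)
qed

lemma families_insert:
  assumes "pol.subspace V"
  shows "families (insert S C) V \<subseteq> ssum (families C V) (single S ` V)"
proof
  fix F assume F: "F \<in> families (insert S C) V"
  let ?G = "\<lambda>S'. if S' = S then 0 else F S'"
  have "?G \<in> families C V" using F pol.subspace_0[OF assms] by (auto simp: families_def)
  moreover have "F = ?G + single S (F S)" by (simp add: single_def fun_eq_iff)
  moreover have "F S \<in> V" using F by (simp add: families_def)
  ultimately show "F \<in> ssum (families C V) (single S ` V)" unfolding ssum_def by blast
qed

lemma fdim_families:
  assumes V: "pol.subspace V" "pol.fdim V" and C: "finite C"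
  shows "chn.fdim (families C V)"
  using C
proof (induction C rule: finite_induct)
  case empty
  have "families {} V \<subseteq> {0}" by (auto simp: families_def)
  then have "families {} V \<subseteq> chn.span {}" by simp
  then show ?case unfolding chn.fdim_def by blast
next
  case (insert S C)
  then show ?case
    using chn.fdim_mono[OF chn.fdim_ssum families_insert[OF V(1)]]
      polchn.fdim_image[OF linear_single V(2)] by blast
qed

text \<open>Evaluation at S maps the families on \<open>insert S C\<close> onto V, with kernel the
  families on C.\<close>

lemma dim_families:
  assumes V: "pol.subspace V" "pol.fdim V" and C: "finite C"
  shows "chn.dim (families C V) = card C * pol.dim V"
  using C
proof (induction C rule: finite_induct)
  case empty
  have "families {} V \<subseteq> {0}" by (auto simp: families_def)
  then show ?case using chn.dim_le_card[of "families {} V" "{}"] by simp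
next
  case (insert S C)
  have "(\<lambda>F. F S) ` families (insert S C) V = V"
  proof
    show "V \<subseteq> (\<lambda>F. F S) ` families (insert S C) V"
    proof
      fix v assume "v \<in> V"
      then have "single S v \<in> families (insert S C) V"
        using pol.subspace_0[OF V(1)] by (simp add: families_def single_def)
      moreover have "v = single S v S" by (simp add: single_def)
      ultimately show "v \<in> (\<lambda>F. F S) ` families (insert S C) V" by blast
    qed
  qed (auto simp: families_def)
  moreover have "{F \<in> families (insert S C) V. F S = 0} = families C V"
    using insert.hyps(2) by (auto simp: families_def)
  ultimately have "chn.dim (families (insert S C) V) = pol.dim V + chn.dim (families C V)"
    using chnpol.rank_nullity[OF linear_eval subspace_families[OF V(1)]
        fdim_families[OF V], of "insert S C" S] insert.hyps(1) by simp
  then show ?case using insert by (simp del: psc_apply)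
qed

definition faces :: "nat \<Rightarrow> nat set set" where
  "faces p = {S. S \<subseteq> {0, 1, 2} \<and> card S = p}"

lemma finite_faces [simp]: "finite (faces p)"
  by (rule finite_subset[of _ "Pow {0, 1, 2}"]) (auto simp: faces_def)

lemma card_faces: "card (faces p) = 3 choose p"
  unfolding faces_def by (subst n_subsets) (simp_all add: numeral_3_eq_3)

text \<open>With p \<le> q the degree q - p is a genuine difference, and the chains are
  \<open>3 choose p\<close> copies of one graded piece of J.\<close>

lemma kchains_eq_families:
  assumes "p \<le> q" "pol.subspace (J \<inter> Rdeg (q - p))"
  shows "kchains J p q = families (faces p) (J \<inter> Rdeg (q - p))"
  using assms by (auto simp: kchains_def families_def faces_def Rdeg_def zero_fun_def)

lemma kdiff_eq: "kdiff F S = (\<Sum>i \<in> {0, 1, 2} - S. psc (ksign i S) (pmul (xvar i) (F (insert i S))))"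
proof
  fix m
  have "(\<Sum>i\<in>A. psc (ksign i S) (pmul (xvar i) (F (insert i S)))) m
      = (\<Sum>i\<in>A. ksign i S * pmul (xvar i) (F (insert i S)) m)" if "finite A" for A
    using that by (induction A rule: finite_induct) auto
  then show "kdiff F S m = (\<Sum>i \<in> {0, 1, 2} - S. psc (ksign i S) (pmul (xvar i) (F (insert i S)))) m"
    by (simp add: kdiff_def)
qed

lemma linear_kdiff: "Vector_Spaces.linear csc csc kdiff"
  unfolding Vector_Spaces.linear_iff
  by (auto simp: chn.vector_space_axioms kdiff_eq csc_eq fun_eq_iff pol.scale_right_distrib
      sum.distrib pol.scale_sum_right pol.scale_left_commute mult.commute simp del: psc_apply)

text \<open>The Koszul matrices in three variables with their signs; that two successive
  differentials compose to zero, and exactness, are read off from them.\<close>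

lemma kdiff_values:
  "kdiff F {} = pmul (xvar 0) (F {0}) + pmul (xvar 1) (F {1}) + pmul (xvar 2) (F {2})"
  "kdiff F {0} = - pmul (xvar 1) (F {0, 1}) - pmul (xvar 2) (F {0, 2})"
  "kdiff F {1} = pmul (xvar 0) (F {0, 1}) - pmul (xvar 2) (F {1, 2})"
  "kdiff F {2} = pmul (xvar 0) (F {0, 2}) + pmul (xvar 1) (F {1, 2})"
  "kdiff F {0, 1} = pmul (xvar 2) (F {0, 1, 2})"
  "kdiff F {0, 2} = - pmul (xvar 1) (F {0, 1, 2})"
  "kdiff F {1, 2} = pmul (xvar 0) (F {0, 1, 2})"
proof -
  have sets: "{0, 1, 2} - {} = {0, 1, 2::nat}" "{0, 1, 2} - {0} = {1, 2::nat}"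
    "{0, 1, 2} - {1} = {0, 2::nat}" "{0, 1, 2} - {2} = {0, 1::nat}" "{0, 1, 2} - {0, 1} = {2::nat}"
    "{0, 1, 2} - {0, 2} = {1::nat}" "{0, 1, 2} - {1, 2} = {0::nat}" by auto
  have ins: "insert 0 {1, 2} = {0, 1, 2::nat}" "insert 1 {0, 2} = {0, 1, 2::nat}"
    "insert 2 {0, 1} = {0, 1, 2::nat}" "insert 1 {0} = {0, 1::nat}" "insert 2 {0} = {0, 2::nat}"
    "insert 2 {1} = {1, 2::nat}" by auto
  have signs: "ksign i {} = (1 :: 'a)" "ksign 1 {0} = (-1 :: 'a)" "ksign 2 {0} = (-1 :: 'a)"
    "ksign 0 {1} = (1 :: 'a)" "ksign 2 {1} = (-1 :: 'a)" "ksign 0 {2} = (1 :: 'a)" "ksign 1 {2} = (1 :: 'a)"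
    "ksign 2 {0, 1} = (1 :: 'a)" "ksign 1 {0, 2} = (-1 :: 'a)" "ksign 0 {1, 2} = (1 :: 'a)" for i
  proof -
    have *: "{j \<in> {0}. j < (1::nat)} = {0}" "{j \<in> {0}. j < (2::nat)} = {0}" "{j \<in> {1}. j < (0::nat)} = {}"
      "{j \<in> {1}. j < (2::nat)} = {1}" "{j \<in> {2}. j < (0::nat)} = {}" "{j \<in> {2}. j < (1::nat)} = {}"
      "{j \<in> {0, 1}. j < (2::nat)} = {0, 1}" "{j \<in> {0, 2}. j < (1::nat)} = {0}" "{j \<in> {1, 2}. j < (0::nat)} = {}"
      by auto
    show "ksign i {} = (1 :: 'a)" "ksign 1 {0} = (-1 :: 'a)" "ksign 2 {0} = (-1 :: 'a)"
    "ksign 0 {1} = (1 :: 'a)" "ksign 2 {1} = (-1 :: 'a)" "ksign 0 {2} = (1 :: 'a)" "ksign 1 {2} = (1 :: 'a)"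
    "ksign 2 {0, 1} = (1 :: 'a)" "ksign 1 {0, 2} = (-1 :: 'a)" "ksign 0 {1, 2} = (1 :: 'a)"
      unfolding ksign_def * by simp_all
  qed
  show "kdiff F {} = pmul (xvar 0) (F {0}) + pmul (xvar 1) (F {1}) + pmul (xvar 2) (F {2})"
  "kdiff F {0} = - pmul (xvar 1) (F {0, 1}) - pmul (xvar 2) (F {0, 2})"
  "kdiff F {1} = pmul (xvar 0) (F {0, 1}) - pmul (xvar 2) (F {1, 2})"
  "kdiff F {2} = pmul (xvar 0) (F {0, 2}) + pmul (xvar 1) (F {1, 2})"
  "kdiff F {0, 1} = pmul (xvar 2) (F {0, 1, 2})"
  "kdiff F {0, 2} = - pmul (xvar 1) (F {0, 1, 2})"
  "kdiff F {1, 2} = pmul (xvar 0) (F {0, 1, 2})"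
    unfolding kdiff_eq sets by (simp_all add: signs[simplified] ins[simplified] fun_eq_iff)
qed

lemma faces_cases:
  "faces 0 = {{}}" "faces 1 = {{0}, {1}, {2}}" "faces 2 = {{0, 1}, {0, 2}, {1, 2}}" "faces 3 = {{0, 1, 2}}"
proof -
  have c: "card {0, 1, 2::nat} = 3" "card {0, 1::nat} = 2" "card {0, 2::nat} = 2" "card {1, 2::nat} = 2"
    by simp_all
  have "Pow {0, 1, 2::nat} = {{}, {0}, {1}, {2}, {0, 1}, {0, 2}, {1, 2}, {0, 1, 2}}"
    by (auto simp: Pow_insert)
  then have f: "faces p = {S \<in> {{}, {0}, {1}, {2}, {0, 1}, {0, 2}, {1, 2}, {0, 1, 2}}. card S = p}" for p
    unfolding faces_def by blast
  show "faces 0 = {{}}" "faces 1 = {{0}, {1}, {2}}" "faces 2 = {{0, 1}, {0, 2}, {1, 2}}"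
    "faces 3 = {{0, 1, 2}}"
    unfolding f using c by auto
qed

lemma insert_in_facesD: "insert i S \<in> faces (Suc p) \<Longrightarrow> i \<notin> S \<Longrightarrow> S \<in> faces p"
  unfolding faces_def
  by (auto dest: finite_subset[of S] simp: card_insert_if)

section \<open>Cycles, boundaries and graded Betti numbers\<close>

definition cycles :: "'k::field pol set \<Rightarrow> nat \<Rightarrow> nat \<Rightarrow> (nat set \<Rightarrow> 'k pol) set" where
  "cycles J p q = {F \<in> kchains J p q. kdiff F = 0}"

text \<open>For a subspace V this is the space R_1 V; one element of V per variable suffices because
  V is closed under linear combinations.\<close>

definition xshadow :: "'k::field pol set \<Rightarrow> 'k pol set" where
  "xshadow V = {pmul (xvar 0) f + pmul (xvar 1) g + pmul (xvar 2) h |f g h. f \<in> V \<and> g \<in> V \<and> h \<in> V}"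

lemma subspace_xshadow:
  assumes V: "pol.subspace V"
  shows "pol.subspace (xshadow V)"
proof (rule pol.subspaceI)
  show "0 \<in> xshadow V"
    unfolding xshadow_def using pol.subspace_0[OF V] by force
  show "x + y \<in> xshadow V" if xy: "x \<in> xshadow V" "y \<in> xshadow V" for x y
  proof -
    obtain f g h f' g' h' where "f \<in> V" "g \<in> V" "h \<in> V" "f' \<in> V" "g' \<in> V" "h' \<in> V"
      "x = pmul (xvar 0) f + pmul (xvar 1) g + pmul (xvar 2) h"
      "y = pmul (xvar 0) f' + pmul (xvar 1) g' + pmul (xvar 2) h'"
      using xy unfolding xshadow_def by blast
    then have "x + y = pmul (xvar 0) (f + f') + pmul (xvar 1) (g + g') + pmul (xvar 2) (h + h')"
      "f + f' \<in> V" "g + g' \<in> V" "h + h' \<in> V"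
      by (simp_all only: pol.subspace_add[OF V]) (simp add: algebra_simps)
    then show ?thesis unfolding xshadow_def by blast
  qed
  show "psc c x \<in> xshadow V" if x: "x \<in> xshadow V" for c x
  proof -
    obtain f g h where "f \<in> V" "g \<in> V" "h \<in> V"
      "x = pmul (xvar 0) f + pmul (xvar 1) g + pmul (xvar 2) h"
      using x unfolding xshadow_def by blast
    then have "psc c x = pmul (xvar 0) (psc c f) + pmul (xvar 1) (psc c g) + pmul (xvar 2) (psc c h)"
      "psc c f \<in> V" "psc c g \<in> V" "psc c h \<in> V"
      by (simp_all only: pol.subspace_scale[OF V]) (simp add: pol.scale_right_distrib del: psc_apply)
    then show ?thesis unfolding xshadow_def by blast
  qed
qed

lemma pmul_xvar_in_xshadow:
  assumes "pol.subspace V" "f \<in> V" "i < 3"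
  shows "pmul (xvar i) f \<in> xshadow V"
proof -
  have "pmul (xvar i) f = pmul (xvar 0) (if i = 0 then f else 0) + pmul (xvar 1) (if i = 1 then f else 0)
      + pmul (xvar 2) (if i = 2 then f else 0)"
    using assms(3) by (auto simp: less_Suc_eq numeral_3_eq_3)
  moreover have "(if i = j then f else 0) \<in> V" for j
    using assms(2) pol.subspace_0[OF assms(1)] by simp
  ultimately show ?thesis unfolding xshadow_def by blast
qed

lemma xshadow_Rdeg:
  assumes "V \<subseteq> Rdeg t"
  shows "xshadow V \<subseteq> Rdeg (Suc t)"
  using assms pmul_xvar_Rdeg unfolding xshadow_def
  by (auto intro!: pol.subspace_add[OF subspace_Rdeg])

text \<open>Closure under the variables is added as a hypothesis degree by degree, because for the
  lex-segment it is verified only where the Hilbert function does not grow.\<close>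

locale graded_space =
  fixes J :: "'k::field pol set"
  assumes subspace_deg: "pol.subspace (J \<inter> Rdeg t)"
begin

lemma fdim_deg: "pol.fdim (J \<inter> Rdeg t)"
  by (rule pol.fdim_mono[OF fdim_Rdeg]) auto

lemma dim_deg_le: "pol.dim (J \<inter> Rdeg t) \<le> card (monoms t)"
  using pol.dim_mono_fdim[OF Int_lower2 fdim_Rdeg] by (metis dim_Rdeg)

lemmas kchains = kchains_eq_families[OF _ subspace_deg]

lemma subspace_kchains: "p \<le> q \<Longrightarrow> chn.subspace (kchains J p q)"
  by (simp add: kchains subspace_families subspace_deg)

lemma fdim_kchains: "p \<le> q \<Longrightarrow> chn.fdim (kchains J p q)"
  by (simp add: kchains fdim_families subspace_deg fdim_deg)

lemma dim_kchains: "p \<le> q \<Longrightarrow> chn.dim (kchains J p q) = (3 choose p) * pol.dim (J \<inter> Rdeg (q - p))"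
  using dim_families[OF subspace_deg fdim_deg finite_faces, of p "q - p"]
  by (simp add: kchains card_faces del: psc_apply)

lemma dim_cycles:
  "p \<le> q \<Longrightarrow> chn.dim (kdiff ` kchains J p q) + chn.dim (cycles J p q)
     = (3 choose p) * pol.dim (J \<inter> Rdeg (q - p))"
  using chnchn.rank_nullity[OF linear_kdiff subspace_kchains fdim_kchains, of p q]
  unfolding cycles_def by (simp add: dim_kchains del: psc_apply)

text \<open>The last differential is injective because multiplication by x_3 is.\<close>

lemma dim_boundaries_3:
  assumes "3 \<le> q"
  shows "chn.dim (kdiff ` kchains J 3 q) = pol.dim (J \<inter> Rdeg (q - 3))"
proof -
  have "F = 0" if F: "F \<in> kchains J 3 q" "kdiff F = 0" for F
  proof -
    have "pmul (xvar 2) (F {0, 1, 2}) = 0" using kdiff_values(5)[of F] F(2) by simp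
    then have "F {0, 1, 2} = 0" by (rule pmul_xvar_inj)
    then have "F S = 0" for S
      using F(1) assms by (cases "S = {0, 1, 2}") (auto simp: kchains families_def faces_cases)
    then show ?thesis by (simp add: fun_eq_iff)
  qed
  then have "chn.dim (kdiff ` kchains J 3 q) = chn.dim (kchains J 3 q)"
    using assms by (intro chnchn.dim_image_inj linear_kdiff subspace_kchains fdim_kchains)
  then show ?thesis by (simp add: dim_kchains[OF assms] del: psc_apply)
qed

lemma dim_boundaries_1:
  assumes "1 \<le> q"
  shows "chn.dim (kdiff ` kchains J 1 q) = pol.dim (xshadow (J \<inter> Rdeg (q - 1)))"
proof -
  let ?V = "J \<inter> Rdeg (q - 1)"
  have K: "kchains J 1 q = families {{0}, {1}, {2}} ?V"
    using assms by (simp only: kchains faces_cases)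
  have S: "pol.subspace (xshadow ?V)" by (rule subspace_xshadow[OF subspace_deg])
  have "xshadow ?V \<subseteq> Rdeg q" using xshadow_Rdeg[of ?V "q - 1"] assms by simp
  then have fS: "pol.fdim (xshadow ?V)" by (rule pol.fdim_mono[OF fdim_Rdeg])
  have "kdiff ` kchains J 1 q = single {} ` xshadow ?V"
  proof
    show "kdiff ` kchains J 1 q \<subseteq> single {} ` xshadow ?V"
    proof
      fix G assume "G \<in> kdiff ` kchains J 1 q"
      then obtain F where F: "F \<in> kchains J 1 q" "G = kdiff F" by blast
      have "G S = 0" if "S \<noteq> {}" for S
      proof -
        have "F (insert i S) = 0" if "i \<notin> S" for i
        proof -
          have "insert i S \<notin> {{0}, {1}, {2}}" using that \<open>S \<noteq> {}\<close> by auto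
          then show ?thesis using F(1) K by (simp add: families_def)
        qed
        then show ?thesis unfolding F(2) kdiff_eq by (intro sum.neutral) simp
      qed
      then have "G = single {} (G {})" by (auto simp: single_def)
      moreover have "G {} \<in> xshadow ?V"
        using F(1) unfolding F(2) kdiff_values(1) K xshadow_def families_def by blast
      ultimately show "G \<in> single {} ` xshadow ?V" by blast
    qed
    show "single {} ` xshadow ?V \<subseteq> kdiff ` kchains J 1 q"
    proof
      fix G assume "G \<in> single {} ` xshadow ?V"
      then obtain f g h where G: "f \<in> ?V" "g \<in> ?V" "h \<in> ?V"
        "G = single {} (pmul (xvar 0) f + pmul (xvar 1) g + pmul (xvar 2) h)"
        unfolding xshadow_def by blast
      define F where "F = single {0} f + single {1} g + single {2} h"
      have F012: "F {0} = f" "F {1} = g" "F {2} = h" by (simp_all add: F_def single_def)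
      have "F \<in> kchains J 1 q"
        using G(1-3) pol.subspace_0[OF subspace_deg, of "q - 1"]
        unfolding K families_def by (auto simp: F_def single_def)
      moreover have "kdiff F S = G S" for S
      proof (cases "S = {}")
        case True
        then show ?thesis by (simp only: kdiff_values F012 G(4)) (simp add: single_def)
      next
        case False
        have "F (insert i S) = 0" if "i \<notin> S" for i
        proof -
          have "insert i S \<noteq> {0}" "insert i S \<noteq> {1}" "insert i S \<noteq> {2}" using that False by auto
          then show ?thesis by (simp only: F_def single_def plus_fun_apply if_False add_0_right)
        qed
        then have "kdiff F S = 0" unfolding kdiff_eq by (intro sum.neutral) simp
        then show ?thesis using False by (simp add: G(4) single_def)
      qed
      ultimately show "G \<in> kdiff ` kchains J 1 q" by (metis ext image_eqI)
    qed
  qed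
  moreover have "chn.dim (single {} ` xshadow ?V) = pol.dim (xshadow ?V)"
  proof (rule polchn.dim_image_inj[OF linear_single S fS])
    fix x :: "'k pol" assume "single {} x = 0"
    then have "single {} x {} = 0" by simp
    then show "x = 0" by (simp add: single_def)
  qed
  ultimately show ?thesis by simp
qed

text \<open>Two differentials compose to zero because the variables commute; \<open>closed\<close>
  keeps the boundary in J. Chains are functions on all index sets, so the vanishing outside the
  faces is checked too.\<close>

lemma boundaries_subset_cycles:
  assumes q: "Suc p \<le> q" and p: "p = 1 \<or> p = 2"
    and closed: "\<And>i f. f \<in> J \<inter> Rdeg (q - Suc p) \<Longrightarrow> pmul (xvar i) f \<in> J"
  shows "kdiff ` kchains J (Suc p) q \<subseteq> cycles J p q"
proof
  fix G assume "G \<in> kdiff ` kchains J (Suc p) q"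
  then obtain F where F: "F \<in> kchains J (Suc p) q" "G = kdiff F" by blast
  have FV: "F S \<in> J \<inter> Rdeg (q - Suc p)" for S
    using F(1) kchains[OF q] by (simp add: families_def)
  have F0: "F S = 0" if "S \<notin> faces (Suc p)" for S
    using F(1) kchains[OF q] that by (simp add: families_def)
  have XV: "pmul (xvar i) (F S) \<in> J \<inter> Rdeg (q - p)" for i S
    using FV[of S] closed pmul_xvar_Rdeg[of "F S" "q - Suc p" i] q by (simp add: Suc_diff_Suc)
  have GV: "G S \<in> J \<inter> Rdeg (q - p)" for S
    unfolding F(2) kdiff_eq
    by (intro pol.subspace_sum pol.subspace_scale subspace_deg XV)
  have G0: "G S = 0" if "S \<notin> faces p" for S
  proof -
    have "F (insert i S) = 0" if i: "i \<in> {0, 1, 2} - S" for i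
    proof -
      have "insert i S \<notin> faces (Suc p)"
        using insert_in_facesD i that \<open>S \<notin> faces p\<close> by blast
      then show ?thesis by (rule F0)
    qed
    then show ?thesis unfolding F(2) kdiff_eq by (intro sum.neutral) simp
  qed
  have G: "G \<in> kchains J p q"
    using GV G0 q by (simp add: kchains families_def)
  have "kdiff G S = 0" for S
  proof (cases "S \<in> faces (p - 1)")
    case True
    show ?thesis
    proof (cases "p = 1")
      case True
      then have "S = {}" using \<open>S \<in> faces (p - 1)\<close> faces_cases by simp
      then show ?thesis
        by (simp only: kdiff_values F(2))
          (simp add: pmul_xvar_commute[of "Suc 0" 0] pmul_xvar_commute[of 2 0] pmul_xvar_commute[of 2 "Suc 0"]
            module_hom.neg[OF linear_pmul_xvar[unfolded module_hom_iff_linear[symmetric]]])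
    next
      case False
      then have "p = 2" using p by simp
      then have "S = {0} \<or> S = {1} \<or> S = {2}" using \<open>S \<in> faces (p - 1)\<close> faces_cases(2) by simp
      then show ?thesis
        by (elim disjE; simp only: kdiff_values F(2))
          (simp_all add: pmul_xvar_commute[of "Suc 0" 0] pmul_xvar_commute[of 2 0] pmul_xvar_commute[of 2 "Suc 0"]
            module_hom.neg[OF linear_pmul_xvar[unfolded module_hom_iff_linear[symmetric]]])
    qed
  next
    case False
    have "G (insert i S) = 0" if i: "i \<in> {0, 1, 2} - S" for i
    proof -
      have "insert i S \<notin> faces p"
        using insert_in_facesD[of i S "p - 1"] i False p by (auto simp: numeral_2_eq_2)
      then show ?thesis by (rule G0)
    qed
    then show ?thesis unfolding kdiff_eq by (intro sum.neutral) simp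
  qed
  then show "G \<in> cycles J p q" using G unfolding cycles_def by (simp add: fun_eq_iff)
qed

lemma fdim_cycles: "p \<le> q \<Longrightarrow> chn.fdim (cycles J p q)"
  by (rule chn.fdim_mono[OF fdim_kchains]) (auto simp: cycles_def)

text \<open>Serves to make the truncated subtraction in \<open>betti\<close> a true
  difference.\<close>

lemma dim_boundaries_le:
  assumes "Suc p \<le> q" "p = 1 \<or> p = 2"
    and "\<And>i f. f \<in> J \<inter> Rdeg (q - Suc p) \<Longrightarrow> pmul (xvar i) f \<in> J"
  shows "chn.dim (kdiff ` kchains J (Suc p) q) \<le> chn.dim (cycles J p q)"
  using chn.dim_mono_fdim[OF boundaries_subset_cycles[OF assms] fdim_cycles] assms(1) by simp

lemma betti_cycles: "betti J p q = chn.dim (cycles J p q) - chn.dim (kdiff ` kchains J (Suc p) q)"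
  unfolding betti_def cycles_def zero_fun_def ..

text \<open>An Euler characteristic in internal degree d + 2: in the difference of the two Betti
  numbers the rank of the middle differential cancels, and only dimensions of graded pieces and of
  the span of the products remain.\<close>

lemma dim_xshadow_if_betti_eq:
  assumes d: "1 \<le> d"
    and closed: "\<And>i f. f \<in> J \<inter> Rdeg (d - 1) \<Longrightarrow> pmul (xvar i) f \<in> J"
      "\<And>i f. f \<in> J \<inter> Rdeg d \<Longrightarrow> pmul (xvar i) f \<in> J"
    and eq: "betti J 1 (d + 2) = betti J 2 (d + 2)"
  shows "pol.dim (xshadow (J \<inter> Rdeg (d + 1))) + 3 * pol.dim (J \<inter> Rdeg d)
      = 3 * pol.dim (J \<inter> Rdeg (d + 1)) + pol.dim (J \<inter> Rdeg (d - 1))"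
proof -
  have c1: "pol.dim (xshadow (J \<inter> Rdeg (d + 1))) + chn.dim (cycles J 1 (d + 2))
      = 3 * pol.dim (J \<inter> Rdeg (d + 1))"
    using dim_cycles[of 1 "d + 2"] dim_boundaries_1[of "d + 2"] by (simp del: psc_apply)
  have c2: "chn.dim (kdiff ` kchains J 2 (d + 2)) + chn.dim (cycles J 2 (d + 2))
      = 3 * pol.dim (J \<inter> Rdeg d)"
    using dim_cycles[of 2 "d + 2"] by (simp add: numeral_eq_Suc del: psc_apply)
  have c3: "chn.dim (kdiff ` kchains J 3 (d + 2)) = pol.dim (J \<inter> Rdeg (d - 1))"
    using dim_boundaries_3[of "d + 2"] d by (simp del: psc_apply)
  have le1: "chn.dim (kdiff ` kchains J 2 (d + 2)) \<le> chn.dim (cycles J 1 (d + 2))"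
    using dim_boundaries_le[of 1 "d + 2"] closed(2) by (simp add: numeral_2_eq_2 del: psc_apply)
  have le2: "chn.dim (kdiff ` kchains J 3 (d + 2)) \<le> chn.dim (cycles J 2 (d + 2))"
    using dim_boundaries_le[of 2 "d + 2"] closed(1) d by (simp add: numeral_3_eq_3 numeral_2_eq_2 del: psc_apply)
  have "chn.dim (cycles J 1 (d + 2)) - chn.dim (kdiff ` kchains J 2 (d + 2))
      = chn.dim (cycles J 2 (d + 2)) - chn.dim (kdiff ` kchains J 3 (d + 2))"
    using eq unfolding betti_cycles by (simp add: numeral_3_eq_3 numeral_2_eq_2 del: psc_apply)
  then show ?thesis using c1 c2 c3 le1 le2 by linarith
qed

text \<open>A 2-cycle in internal degree d + 2 comes from a socle element of degree d - 1, so here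
  every such cycle is a boundary. The same Euler count then gives an inequality, as the first Betti
  number is nonnegative.\<close>

lemma dim_xshadow_if_socle_zero:
  assumes d: "1 \<le> d"
    and closed: "\<And>i f. f \<in> J \<inter> Rdeg d \<Longrightarrow> pmul (xvar i) f \<in> J"
    and socle: "\<And>p. p \<in> Rdeg (d - 1) \<Longrightarrow> (\<And>i. i < 3 \<Longrightarrow> pmul (xvar i) p \<in> J) \<Longrightarrow> p \<in> J"
  shows "pol.dim (xshadow (J \<inter> Rdeg (d + 1))) + 3 * pol.dim (J \<inter> Rdeg d)
      \<le> 3 * pol.dim (J \<inter> Rdeg (d + 1)) + pol.dim (J \<inter> Rdeg (d - 1))"
proof -
  have "cycles J 2 (d + 2) \<subseteq> kdiff ` kchains J 3 (d + 2)"
  proof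
    fix F assume "F \<in> cycles J 2 (d + 2)"
    then have F: "F \<in> families {{0, 1}, {0, 2}, {1, 2}} (J \<inter> Rdeg d)" "kdiff F = 0"
      unfolding cycles_def by (auto simp: kchains faces_cases)
    define A B C where "A = F {0, 1}" and "B = F {0, 2}" and "C = F {1, 2}"
    have ABC: "A \<in> J \<inter> Rdeg d" "B \<in> J \<inter> Rdeg d" "C \<in> J \<inter> Rdeg d"
      using F(1) by (auto simp: families_def A_def B_def C_def)
    have eqs: "- pmul (xvar 1) A - pmul (xvar 2) B = 0" "pmul (xvar 0) A - pmul (xvar 2) C = 0"
      using kdiff_values(2,3)[of F] F(2) by (simp_all add: A_def B_def C_def)
    \<comment> \<open>The quotient of A by x_3: the relation x_1 A = x_3 C shows that A has no
      monomial free of x_3.\<close>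
    define p where "p = (\<lambda>(a, b, c). A (a, b, Suc c))"
    have A: "A = pmul (xvar 2) p"
    proof
      fix m :: "nat \<times> nat \<times> nat"
      obtain a b c where m: "m = (a, b, c)" by (cases m)
      have "pmul (xvar 0) A (Suc a, b, 0) = pmul (xvar 2) C (Suc a, b, 0)" using eqs(2) by simp
      then have "A (a, b, 0) = 0" by (simp add: pmul_xvar_apply)
      then show "A m = pmul (xvar 2) p m" by (cases c) (simp_all add: m pmul_xvar_apply p_def)
    qed
    have "pmul (xvar 2) (pmul (xvar 0) p - C) = 0"
      using eqs(2) by (simp add: A pmul_xvar_commute[of 2 0])
    then have C: "C = pmul (xvar 0) p" using pmul_xvar_inj by (metis eq_iff_diff_eq_0)
    have "pmul (xvar 2) (pmul (xvar 1) p + B) = - (- pmul (xvar 1) A - pmul (xvar 2) B)"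
      by (simp add: A pmul_xvar_commute[of 2 "Suc 0"])
    then have "pmul (xvar 2) (pmul (xvar 1) p + B) = 0" unfolding eqs(1) by simp
    then have B: "pmul (xvar 1) p + B = 0" by (rule pmul_xvar_inj)
    then have B': "pmul (xvar 1) p = - B" "B = - pmul (xvar 1) p" by (simp_all add: eq_neg_iff_add_eq_0 add.commute)
    have "homog d A" using ABC(1) by (simp add: Rdeg_def)
    then have pd: "p \<in> Rdeg (d - 1)"
      unfolding Rdeg_def homog_def p_def by (fastforce simp: mdeg_def)
    \<comment> \<open>Up to sign, A, B and C are the products of p with the three variables, so p
      represents a socle element and lies in J by hypothesis.\<close>
    have "pmul (xvar i) p \<in> J" if "i < 3" for i
    proof -
      have "- B \<in> J \<inter> Rdeg d" using pol.subspace_neg[OF subspace_deg ABC(2)] .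
      moreover have "i = 0 \<or> i = 1 \<or> i = 2" using that by auto
      ultimately show ?thesis using ABC A B'(1) C by (metis IntD1)
    qed
    then have pJ: "p \<in> J" using socle pd by blast
    define G where "G = single {0, 1, 2} p"
    have "G \<in> kchains J 3 (d + 2)"
      using pJ pd pol.subspace_0[OF subspace_deg, of "d - 1"] d
      by (simp add: kchains faces_cases families_def G_def single_def)
    moreover have "kdiff G S = F S" for S
    proof (cases "S \<in> {{0, 1}, {0, 2}, {1, 2}}")
      case True
      have Gp: "G {0, 1, 2} = p" by (simp add: G_def single_def)
      have "kdiff G {0, 1} = F {0, 1}" unfolding kdiff_values Gp using A unfolding A_def ..
      moreover have "kdiff G {0, 2} = F {0, 2}" unfolding kdiff_values Gp using B'(2) unfolding B_def ..
      moreover have "kdiff G {1, 2} = F {1, 2}" unfolding kdiff_values Gp using C unfolding C_def ..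
      ultimately show ?thesis using True by blast
    next
      case False
      have "G (insert i S) = 0" if "i \<in> {0, 1, 2} - S" for i
      proof -
        have "insert i S \<notin> faces 3"
          using insert_in_facesD[of i S 2] that False[folded faces_cases(3)] by auto
        then have "insert i S \<noteq> {0, 1, 2}" by (simp add: faces_cases(4))
        then show ?thesis by (simp add: G_def single_def)
      qed
      then have "kdiff G S = 0" unfolding kdiff_eq by (intro sum.neutral) simp
      then show ?thesis using False F(1) by (simp add: families_def)
    qed
    ultimately show "F \<in> kdiff ` kchains J 3 (d + 2)" by (intro image_eqI[of _ _ G] ext) simp_all
  qed
  moreover have "chn.fdim (kdiff ` kchains J 3 (d + 2))"
    using d by (intro chnchn.fdim_image linear_kdiff fdim_kchains) simp
  ultimately have "chn.dim (cycles J 2 (d + 2)) \<le> chn.dim (kdiff ` kchains J 3 (d + 2))"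
    by (rule chn.dim_mono_fdim)
  moreover have "chn.dim (kdiff ` kchains J 3 (d + 2)) = pol.dim (J \<inter> Rdeg (d - 1))"
    using dim_boundaries_3[of "d + 2"] d by (simp del: psc_apply)
  moreover have "pol.dim (xshadow (J \<inter> Rdeg (d + 1))) + chn.dim (cycles J 1 (d + 2))
      = 3 * pol.dim (J \<inter> Rdeg (d + 1))"
    using dim_cycles[of 1 "d + 2"] dim_boundaries_1[of "d + 2"] by (simp del: psc_apply)
  moreover have "chn.dim (kdiff ` kchains J 2 (d + 2)) + chn.dim (cycles J 2 (d + 2))
      = 3 * pol.dim (J \<inter> Rdeg d)"
    using dim_cycles[of 2 "d + 2"] by (simp add: numeral_eq_Suc del: psc_apply)
  moreover have "chn.dim (kdiff ` kchains J 2 (d + 2)) \<le> chn.dim (cycles J 1 (d + 2))"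
    using dim_boundaries_le[of 1 "d + 2"] closed by (simp add: numeral_2_eq_2 del: psc_apply)
  ultimately show ?thesis by linarith
qed

end

section \<open>Lex segments\<close>

text \<open>The number of larger elements is injective by totality and always below card S, so it
  numbers S by 0, ..., card S - 1.\<close>

lemma card_rank_less:
  assumes "finite S" "n \<le> card S"
    and irrefl: "\<And>x. \<not> gt x x" and trans: "\<And>x y z. gt x y \<Longrightarrow> gt y z \<Longrightarrow> gt x z"
    and total: "\<And>x y. x \<noteq> y \<Longrightarrow> gt x y \<or> gt y x"
  shows "card {x \<in> S. card {y \<in> S. gt y x} < n} = n"
proof -
  define rk where "rk x = card {y \<in> S. gt y x}" for x
  have less: "rk x < rk y" if "x \<in> S" "gt x y" for x y
  proof -
    have "{z \<in> S. gt z x} \<subset> {z \<in> S. gt z y}" using that irrefl trans by blast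
    then show ?thesis unfolding rk_def using assms(1) by (intro psubset_card_mono) simp_all
  qed
  have inj: "inj_on rk S"
    by (rule inj_onI) (metis less less_irrefl total)
  have "rk x < card S" if "x \<in> S" for x
  proof -
    have "{z \<in> S. gt z x} \<subset> S" using that irrefl by blast
    then show ?thesis unfolding rk_def using assms(1) by (intro psubset_card_mono) simp_all
  qed
  then have "rk ` S \<subseteq> {..<card S}" by blast
  then have "rk ` S = {..<card S}"
    using card_image[OF inj] by (intro card_subset_eq) auto
  moreover have "rk ` {x \<in> S. rk x < n} = rk ` S \<inter> {..<n}" by auto
  ultimately have "rk ` {x \<in> S. rk x < n} = {..<n}" using assms(2) by auto
  then have "card {x \<in> S. rk x < n} = n"
    using card_image[OF inj_on_subset[OF inj], of "{x \<in> S. rk x < n}"] by simp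
  then show ?thesis by (simp add: rk_def)
qed

lemma lex_gt_irrefl: "\<not> lex_gt m m"
  by (auto simp: lex_gt_def split: prod.splits)

lemma lex_gt_trans: "lex_gt l m \<Longrightarrow> lex_gt m n \<Longrightarrow> lex_gt l n"
  by (auto simp: lex_gt_def split: prod.splits)

lemma lex_gt_total: "m \<noteq> n \<Longrightarrow> lex_gt m n \<or> lex_gt n m"
  by (auto simp: lex_gt_def split: prod.splits)

section \<open>Growth of initial lex-segments\<close>

definition lex_above :: "nat \<Rightarrow> nat \<times> nat \<times> nat \<Rightarrow> (nat \<times> nat \<times> nat) set" where
  "lex_above t m = {m' \<in> monoms t. lex_gt m' m}"

lemma toplex_eq: "toplex t n = {m \<in> monoms t. card (lex_above t m) < n}"
  by (simp add: toplex_def lex_above_def)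

lemma lex_above_subset: "lex_above t m \<subseteq> monoms t"
  by (auto simp: lex_above_def)

lemma finite_lex_above [simp]: "finite (lex_above t m)"
  using finite_subset[OF lex_above_subset] by simp

lemma toplex_subset: "toplex t n \<subseteq> monoms t"
  by (auto simp: toplex_eq)

lemma finite_toplex [simp]: "finite (toplex t n)"
  using finite_subset[OF toplex_subset] by simp

lemma card_toplex: "n \<le> card (monoms t) \<Longrightarrow> card (toplex t n) = n"
  unfolding toplex_eq lex_above_def
  by (rule card_rank_less[OF finite_monoms _ lex_gt_irrefl lex_gt_trans lex_gt_total])

lemma card_not_lex_above: "card {m' \<in> monoms t. \<not> lex_gt m' m} + card (lex_above t m) = card (monoms t)"
proof -
  have "monoms t = {m' \<in> monoms t. \<not> lex_gt m' m} \<union> lex_above t m"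
    "{m' \<in> monoms t. \<not> lex_gt m' m} \<inter> lex_above t m = {}" by (auto simp: lex_above_def)
  then show ?thesis by (metis (no_types, lifting) card_Un_disjoint finite_Un finite_monoms)
qed

text \<open>Multiplication by x_3 sends monomials not above m to monomials not above x_i m. So at
  least as many monomials are not above x_i m as are not above m, and if the codimension does not
  grow, x_i m stays in the segment.\<close>

lemma up_in_toplex:
  assumes m: "m \<in> toplex t n" and n: "n \<le> card (monoms t)"
    and le: "card (monoms (Suc t)) - n' \<le> card (monoms t) - n"
  shows "up i m \<in> toplex (Suc t) n'"
proof -
  have "\<not> lex_gt (up 2 m') (up i m)" if "\<not> lex_gt m' m" for m'
    using that by (auto simp: lex_gt_def up_def split: prod.splits if_splits)
  then have "up 2 ` {m' \<in> monoms t. \<not> lex_gt m' m} \<subseteq> {m' \<in> monoms (Suc t). \<not> lex_gt m' (up i m)}"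
    by auto
  then have "card {m' \<in> monoms t. \<not> lex_gt m' m} \<le> card {m' \<in> monoms (Suc t). \<not> lex_gt m' (up i m)}"
    by (rule card_inj_on_le[OF inj_on_subset[OF inj_up subset_UNIV]])
      (rule finite_subset[OF _ finite_monoms[of "Suc t"]], blast)
  moreover have "card (lex_above t m) < n" "mdeg m = t" using m by (auto simp: toplex_eq)
  ultimately have "card (lex_above (Suc t) (up i m)) < n'"
    using card_not_lex_above[of t m] card_not_lex_above[of "Suc t" "up i m"] n le by linarith
  then show ?thesis using \<open>mdeg m = t\<close> by (simp add: toplex_eq)
qed

text \<open>Three disjoint sets share degree t + 1: the multiples of the segment \<open>T\<close>,
  x_3 times its complement \<open>Q\<close>, and the b monomials x_1^l x_2^(t+1-l) with l <
  b.\<close>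

lemma card_shadow_toplex:
  assumes n: "n \<le> card (monoms t)" and b: "b \<le> Suc t" and tri: "tri t b \<le> card (monoms t) - n"
  shows "card (\<Union>i. up i ` toplex t n) + (card (monoms t) - n) + b \<le> card (monoms (Suc t))"
proof -
  define T where "T = toplex t n"
  define sh where "sh = (\<Union>i. up i ` T)"
  define Q where "Q = monoms t - T"
  define B where "B = (\<lambda>l. (l, Suc t - l, 0::nat)) ` {..<b}"
  have rank: "card (lex_above t m) < n" "mdeg m = t" if "m \<in> T" for m
    using that by (auto simp: T_def toplex_eq)
  have "up 2 q \<noteq> up i m" if q: "q \<in> Q" and m: "m \<in> T" for q m i
  proof
    assume e: "up 2 q = up i m"
    have "q \<noteq> m" using q m by (auto simp: Q_def)
    \<comment> \<open>Here q arises from m by trading x_3 for x_1 or x_2, so q is lex-larger than m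
      and would belong to the segment.\<close>
    then have "lex_gt q m" using e by (auto simp: up_def lex_gt_def split: prod.splits if_splits)
    then have "lex_above t q \<subseteq> lex_above t m" unfolding lex_above_def using lex_gt_trans by blast
    then have "card (lex_above t q) \<le> card (lex_above t m)" by (intro card_mono) simp_all
    then show False using rank[OF m] q by (auto simp: Q_def T_def toplex_eq)
  qed
  then have 1: "up 2 ` Q \<inter> sh = {}" unfolding sh_def by blast
  \<comment> \<open>Otherwise all monomials with x_1-exponent at least b lie above m, and by the
    bound on \<open>tri t b\<close> there are at least n of them.\<close>
  have fst_T: "b \<le> fst m" if m: "m \<in> T" for m
  proof (rule ccontr)
    assume "\<not> b \<le> fst m"
    then have "monoms t - {m' \<in> monoms t. fst m' < b} \<subseteq> lex_above t m"
      by (auto simp: lex_above_def lex_gt_def split: prod.splits)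
    then have "card (monoms t - {m' \<in> monoms t. fst m' < b}) \<le> card (lex_above t m)"
      by (intro card_mono) simp_all
    moreover have "card (monoms t - {m' \<in> monoms t. fst m' < b}) = card (monoms t) - tri t b"
      unfolding card_monoms_fst[symmetric]
      by (intro card_Diff_subset finite_subset[OF _ finite_monoms[of t]]) auto
    ultimately show False using rank(1)[OF m] tri n by linarith
  qed
  have "fst m \<le> fst (up i m)" for m i by (auto simp: up_def split: prod.splits)
  then have "b \<le> fst x" if "x \<in> sh" for x
    using that fst_T le_trans unfolding sh_def by blast
  then have 2: "B \<inter> sh = {}" by (force simp: B_def)
  have 3: "up 2 ` Q \<inter> B = {}" by (auto simp: B_def up_def split: prod.splits)
  have sub: "sh \<subseteq> monoms (Suc t)" "up 2 ` Q \<subseteq> monoms (Suc t)" "B \<subseteq> monoms (Suc t)"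
  proof -
    have "up i ` T \<subseteq> monoms (Suc t)" for i
    proof
      fix x assume "x \<in> up i ` T"
      then obtain m where "m \<in> T" "x = up i m" by blast
      then show "x \<in> monoms (Suc t)" using rank(2) by simp
    qed
    then show "sh \<subseteq> monoms (Suc t)" unfolding sh_def by blast
    show "B \<subseteq> monoms (Suc t)" using b by (auto simp: B_def mdeg_def)
  qed (auto simp: Q_def)
  then have fin: "finite sh" "finite (up 2 ` Q)" "finite B"
    using finite_subset finite_monoms by blast+
  have "card sh + card (up 2 ` Q) + card B = card (sh \<union> up 2 ` Q \<union> B)"
    using 1 2 3 fin by (subst card_Un_disjoint, simp, simp, blast, subst card_Un_disjoint) auto
  also have "\<dots> \<le> card (monoms (Suc t))" using sub by (intro card_mono) auto
  finally have "card sh + card (up 2 ` Q) + card B \<le> card (monoms (Suc t))" .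
  moreover have "card (up 2 ` Q) = card (monoms t) - n"
    using card_toplex[OF n] toplex_subset[of t n]
    by (simp add: card_image[OF inj_on_subset[OF inj_up]] Q_def T_def card_Diff_subset)
  moreover have "card B = b" by (simp add: B_def card_image inj_on_def)
  ultimately show ?thesis by (simp add: sh_def T_def)
qed

section \<open>Socle and conclusion\<close>

lemma kdim_eq_dim: "kdim V = pol.dim V"
  by (simp only: kdim_def)

lemma lexI_Int_Rdeg: "lexI I \<inter> Rdeg t = supported (toplex t (pol.dim (I \<inter> Rdeg t)))" (is "?L = ?R")
proof
  show "?L \<subseteq> ?R"
  proof
    fix f assume f: "f \<in> ?L"
    show "f \<in> ?R"
      unfolding supported_def
    proof (intro CollectI allI impI)
      fix m assume m: "f m \<noteq> 0"
      then have "mdeg m = t" using f unfolding Rdeg_def homog_def by blast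
      then show "m \<in> toplex t (pol.dim (I \<inter> Rdeg t))"
        using f m unfolding lexI_def kdim_eq_dim by blast
    qed
  qed
  show "?R \<subseteq> ?L"
  proof
    fix f assume f: "f \<in> ?R"
    then have "f \<in> polR" using supported_subset_polR[OF finite_toplex] by blast
    moreover have "\<forall>m. f m \<noteq> 0 \<longrightarrow> mdeg m = t"
      using f toplex_subset unfolding supported_def monoms_def by blast
    ultimately show "f \<in> ?L"
      using f unfolding lexI_def Rdeg_def homog_def supported_def kdim_eq_dim by auto
  qed
qed

lemma graded_space_lexI: "graded_space (lexI I)"
  by unfold_locales (simp only: lexI_Int_Rdeg subspace_supported)

lemma dim_supported_toplex:
  "n \<le> card (monoms t) \<Longrightarrow> pol.dim (supported (toplex t n) :: 'k::field pol set) = n"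
  using dim_supported[OF finite_toplex] card_toplex by metis

lemma pmul_xvar_supported_toplex:
  fixes f :: "'k::field pol"
  assumes f: "f \<in> supported (toplex t n)" and n: "n \<le> card (monoms t)"
    and le: "card (monoms (Suc t)) - n' \<le> card (monoms t) - n"
  shows "pmul (xvar i) f \<in> supported (toplex (Suc t) n')"
  using f by (rule pmul_xvar_supported) (rule up_in_toplex[OF _ n le])

lemma dim_xshadow_supported:
  assumes "finite T"
  shows "pol.dim (xshadow (supported T) :: 'k::field pol set) \<le> card (\<Union>i. up i ` T)"
proof -
  have sub: "xshadow (supported T) \<subseteq> (supported (\<Union>i. up i ` T) :: 'k pol set)"
  proof -
    have "pmul (xvar i) f \<in> supported (\<Union>i. up i ` T)" if "f \<in> supported T" for i and f :: "'k pol"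
      using that by (rule pmul_xvar_supported) blast
    then show ?thesis
      unfolding xshadow_def by (auto intro!: pol.subspace_add[OF subspace_supported])
  qed
  \<comment> \<open>The union runs over all indices; it is finite because \<open>up\<close> takes
    only three values.\<close>
  have "range up \<subseteq> {up 0, up 1, up 2}"
  proof
    fix F assume "F \<in> range up"
    then obtain i where F: "F = up i" by blast
    show "F \<in> {up 0, up 1, up 2}"
      by (cases "i = 0 \<or> i = 1") (auto simp: F up_def fun_eq_iff)
  qed
  then have "finite (range up)" by (rule finite_subset) simp
  then have "finite (\<Union> ((\<lambda>F. F ` T) ` range up))"
    using assms by (intro finite_UN_I) simp_all
  then have fin: "finite (\<Union>i. up i ` T)" by (simp only: image_image)
  show ?thesis
    using pol.dim_mono_fdim[OF sub fdim_supported[OF fin]] dim_supported[OF fin] by metis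
qed

text \<open>Scalars act as constant polynomials; this is how ideals become closed under
  \<open>psc\<close>.\<close>

lemma pmul_const: "pmul (\<lambda>m. if m = (0, 0, 0) then c else 0) f = psc c f"
proof (rule ext)
  fix m :: "nat \<times> nat \<times> nat"
  obtain x y z where m: "m = (x, y, z)" by (cases m)
  have "pmul (\<lambda>m. if m = (0, 0, 0) then c else 0) f m
      = (\<Sum>p \<in> {0..x} \<times> {0..y} \<times> {0..z}. if p = (0, 0, 0) then c * f m else 0)"
    unfolding m pmul_def prod.case by (intro sum.cong) (auto split: if_splits)
  also have "\<dots> = psc c f m" by (subst sum.delta) auto
  finally show "pmul (\<lambda>m. if m = (0, 0, 0) then c else 0) f m = psc c f m" .
qed

section \<open>Graded pieces and socle of a homogeneous ideal\<close>

context
  fixes I :: "'k::field pol set"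
  assumes I: "homog_ideal I"
begin

lemma ideal_zero: "0 \<in> I"
  using I by (simp add: homog_ideal_def zero_fun_def)

lemma ideal_add: "f \<in> I \<Longrightarrow> g \<in> I \<Longrightarrow> f + g \<in> I"
  using I by (simp add: homog_ideal_def padd_def plus_fun_def)

lemma ideal_psc: "f \<in> I \<Longrightarrow> psc c f \<in> I"
proof -
  assume "f \<in> I"
  moreover have "(\<lambda>m. if m = (0, 0, 0) then c else 0) \<in> polR"
    by (rule subsetD[OF supported_subset_polR[of "{(0, 0, 0)}"]]) (auto simp: supported_def split: if_splits)
  ultimately show ?thesis using I pmul_const unfolding homog_ideal_def by metis
qed

lemma ideal_pmul_xvar: "f \<in> I \<Longrightarrow> pmul (xvar i) f \<in> I"
proof -
  assume "f \<in> I"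
  moreover have "(xvar i :: 'k pol) \<in> polR"
    by (rule subsetD[OF supported_subset_polR[of "{unitvec i}"]])
      (auto simp: supported_def xvar_def split: if_splits)
  ultimately show ?thesis using I unfolding homog_ideal_def by blast
qed

lemma ideal_hcomp: "f \<in> I \<Longrightarrow> hcomp t f \<in> I"
  using I by (simp add: homog_ideal_def)

lemma graded_space_ideal: "graded_space I"
proof
  show "pol.subspace (I \<inter> Rdeg t)" for t
  proof (rule pol.subspaceI)
    show "0 \<in> I \<inter> Rdeg t" using ideal_zero pol.subspace_0[OF subspace_Rdeg] by blast
    show "x + y \<in> I \<inter> Rdeg t" if "x \<in> I \<inter> Rdeg t" "y \<in> I \<inter> Rdeg t" for x y
      using that ideal_add pol.subspace_add[OF subspace_Rdeg] by blast
    show "psc c x \<in> I \<inter> Rdeg t" if "x \<in> I \<inter> Rdeg t" for c x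
      using that ideal_psc pol.subspace_scale[OF subspace_Rdeg] by blast
  qed
qed

lemma hilb_eq: "hilb I t = card (monoms t) - pol.dim (I \<inter> Rdeg t)"
  unfolding hilb_def kdim_eq_dim dim_Rdeg ..

lemma Rdeg_subset_ideal_iff: "hilb I t = 0 \<longleftrightarrow> Rdeg t \<subseteq> I"
proof
  interpret graded_space I by (rule graded_space_ideal)
  have dR: "pol.dim (Rdeg t :: 'k pol set) = card (monoms t)" by (rule dim_Rdeg)
  show "Rdeg t \<subseteq> I" if "hilb I t = 0"
  proof -
    have "pol.dim (Rdeg t :: 'k pol set) \<le> pol.dim (I \<inter> Rdeg t)"
      using that unfolding hilb_eq dR by simp
    then have "I \<inter> Rdeg t = Rdeg t"
      by (rule pol.subspace_eqI_dim[OF subspace_deg Int_lower2 fdim_Rdeg])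
    then show ?thesis by blast
  qed
  show "hilb I t = 0" if "Rdeg t \<subseteq> I"
  proof -
    have "I \<inter> Rdeg t = Rdeg t" using that by blast
    then show ?thesis unfolding hilb_eq using dR by (simp del: psc_apply)
  qed
qed

lemma hcomp_Rdeg:
  assumes "homog t f"
  shows "hcomp t f = f" "j \<noteq> t \<Longrightarrow> hcomp j f = 0"
proof -
  have z: "f m = 0" if "mdeg m \<noteq> t" for m using assms that unfolding homog_def by blast
  then show "hcomp t f = f" unfolding hcomp_def by (intro ext) simp
  show "hcomp j f = 0" if "j \<noteq> t" unfolding hcomp_def using that z by (intro ext) simp
qed

lemma hcomp_diff: "hcomp t (\<lambda>m. f m - g m) = hcomp t f - hcomp t g"
  by (auto simp: hcomp_def fun_eq_iff)

text \<open>A nonzero element of top degree s is a socle element, which forces the single socle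
  degree e to be s. A socle element of another degree is congruent to a form of degree e, and
  comparing homogeneous components puts it into I.\<close>

lemma level_socle:
  assumes level: "level I" and s: "socle_degree I s" and j: "j < s"
    and a: "a \<in> Rdeg j" and socle: "\<And>i. i < 3 \<Longrightarrow> pmul (xvar i) a \<in> I"
  shows "a \<in> I"
proof -
  obtain e where e: "\<And>a. a \<in> polR \<Longrightarrow> (\<And>i. i < 3 \<Longrightarrow> pmul (xvar i) a \<in> I) \<Longrightarrow>
      \<exists>b. homog e b \<and> (\<lambda>m. a m - b m) \<in> I"
    using level unfolding level_def by blast
  have in_I: "a \<in> I" if a: "a \<in> Rdeg t" "t \<noteq> e" "\<And>i. i < 3 \<Longrightarrow> pmul (xvar i) a \<in> I" for a t
  proof -
    obtain b where b: "homog e b" "(\<lambda>m. a m - b m) \<in> I"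
      using e[OF _ a(3)] Rdeg_subset_polR a(1) by blast
    have "hcomp t (\<lambda>m. a m - b m) \<in> I" using ideal_hcomp b(2) by blast
    moreover have "hcomp t a = a" using a(1) hcomp_Rdeg(1) unfolding Rdeg_def by blast
    ultimately show ?thesis using hcomp_Rdeg(2)[OF b(1) a(2)] unfolding hcomp_diff by simp
  qed
  have "hilb I s \<noteq> 0" "hilb I (Suc s) = 0" using s unfolding socle_degree_def by auto
  then obtain f where f: "f \<in> Rdeg s" "f \<notin> I" and top: "Rdeg (Suc s) \<subseteq> I"
    unfolding Rdeg_subset_ideal_iff by blast
  have "s = e" using in_I[OF f(1)] f(2) top pmul_xvar_Rdeg[OF f(1)] by blast
  then show ?thesis using in_I[OF a _ socle] j by blast
qed

end

theorem theorem4p5: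
  fixes I :: "('k::field_char_0) pol set" and s d :: nat
  assumes "homog_ideal I"
    and "artinian I"
    and "socle_degree I s"
    and "1 \<le> d"
    and "hilb I (d - 1) > hilb I d"
    and "hilb I d = hilb I (d + 1)"
    and "d < s"
    and "betti (lexI I) 1 (d + 2) = betti (lexI I) 2 (d + 2)"
  shows "\<not> level I"
proof
  assume level: "level I"
  define t where "t = Suc d"
  define n where "n j = pol.dim (I \<inter> Rdeg j)" for j
  define r where "r j = card (monoms j)" for j
  interpret I: graded_space I by (rule graded_space_ideal[OF assms(1)])
  interpret J: graded_space "lexI I" by (rule graded_space_lexI)
  note I_X = ideal_pmul_xvar[OF assms(1)]
  have n_le: "n j \<le> r j" for j unfolding n_def r_def by (rule I.dim_deg_le)
  have hilb: "hilb I j = r j - n j" for j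
    unfolding r_def n_def by (rule hilb_eq[OF assms(1)])
  have h: "r d - n d < r (d - 1) - n (d - 1)" "r d - n d = r t - n t"
    using assms(5,6) unfolding hilb t_def by simp_all
  have r_Suc: "r (Suc j) = r j + Suc (Suc j)" for j unfolding r_def by (rule card_monoms_Suc)
  have socle: "a \<in> I" if "a \<in> Rdeg j" "j \<le> d" "\<And>i. i < 3 \<Longrightarrow> pmul (xvar i) a \<in> I" for a j
    using level_socle[OF assms(1) level assms(3) _ that(1,3)] that(2) assms(7) by simp

  define V where "V = I \<inter> Rdeg t"
  define S where "S = xshadow V"
  have V: "pol.subspace V" "pol.fdim V" "V \<subseteq> Rdeg t" "pol.dim V = n t"
    unfolding V_def n_def by (rule I.subspace_deg I.fdim_deg Int_lower2 refl)+
  have S: "pol.subspace S" "pol.fdim S"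
    unfolding S_def using subspace_xshadow[OF V(1)] pol.fdim_mono[OF fdim_Rdeg xshadow_Rdeg[OF V(3)]]
    by blast+
  obtain \<alpha> \<beta> where green: "tri t (r t - pol.dim (ssum V (lform \<alpha> \<beta> ` Rbelow t))) \<le> r t - n t"
    using hyperplane_restriction[OF V(1,3)] unfolding r_def V(4) by blast
  define W where "W = ssum V (lform \<alpha> \<beta> ` Rbelow t)"
  define b where "b = r t - pol.dim W"
  have tri_b: "tri t b \<le> r t - n t" using green unfolding b_def W_def .
  have W: "pol.subspace W" "W \<subseteq> Rdeg t" "V \<subseteq> W" "lform \<alpha> \<beta> ` Rbelow t \<subseteq> W"
    unfolding W_def using pol.subspace_ssum[OF V(1) subspace_lform_Rbelow] ssum_Rdeg_subset[OF V(3)]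
      pol.ssum_upper(1)[OF subspace_lform_Rbelow] pol.ssum_upper(2)[OF V(1)] by blast+
  have dimW: "pol.dim W + b = r t"
    using pol.dim_mono_fdim[OF W(2) fdim_Rdeg] unfolding dim_Rdeg b_def r_def by simp
  \<comment> \<open>Otherwise h_d = h_{d+1} would force the dimension of R_{d+1} to be at most that
    of R_d.\<close>
  have "n t \<noteq> 0" using h(2) r_Suc[of d] n_le[of d] unfolding t_def by linarith
  \<comment> \<open>For larger b the value \<open>tri t b\<close> would be the full dimension of
    degree t, leaving no room for the nonzero V. The bound allows a complementary form for
    \<open>W\<close> below.\<close>
  have "b \<le> t"
  proof (rule ccontr)
    assume "\<not> b \<le> t"
    then have "tri t (Suc t) \<le> tri t b" by (intro tri_mono) simp
    moreover have "r t = tri t (Suc t)" unfolding r_def by (rule card_monoms)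
    ultimately have "r t \<le> r t - n t" using tri_b by linarith
    then show False using \<open>n t \<noteq> 0\<close> n_le[of t] by simp
  qed

  have J_dim: "pol.dim (lexI I \<inter> Rdeg j) = n j" for j
    unfolding lexI_Int_Rdeg using dim_supported_toplex n_le unfolding n_def r_def by blast
  \<comment> \<open>The lex-segment absorbs the variables wherever the Hilbert function does not
    grow; this covers the degrees d - 1 and d.\<close>
  have J_closed: "pmul (xvar i) f \<in> lexI I"
    if "f \<in> lexI I \<inter> Rdeg j" "r (Suc j) - n (Suc j) \<le> r j - n j" for i j f
    using pmul_xvar_supported_toplex[of f j "n j" "n (Suc j)" i] that n_le[of j]
      lexI_Int_Rdeg[of I j] lexI_Int_Rdeg[of I "Suc j"] unfolding n_def r_def by blast
  have eq: "pol.dim (xshadow (lexI I \<inter> Rdeg t)) + 3 * n d = 3 * n t + n (d - 1)"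
  proof -
    have "pol.dim (xshadow (lexI I \<inter> Rdeg (d + 1))) + 3 * pol.dim (lexI I \<inter> Rdeg d)
        = 3 * pol.dim (lexI I \<inter> Rdeg (d + 1)) + pol.dim (lexI I \<inter> Rdeg (d - 1))"
    proof (rule J.dim_xshadow_if_betti_eq[OF assms(4) _ _ assms(8)])
      show "pmul (xvar i) f \<in> lexI I" if "f \<in> lexI I \<inter> Rdeg (d - 1)" for i f
        using J_closed[OF that] h(1) assms(4) by simp
      show "pmul (xvar i) f \<in> lexI I" if "f \<in> lexI I \<inter> Rdeg d" for i f
        using J_closed[OF that] h(2) unfolding t_def by simp
    qed
    then show ?thesis unfolding J_dim t_def by simp
  qed
  have "pol.dim (xshadow (lexI I \<inter> Rdeg t)) + (r t - n t) + b \<le> r (Suc t)"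
  proof -
    have "pol.dim (xshadow (lexI I \<inter> Rdeg t)) \<le> card (\<Union>i. up i ` toplex t (n t))"
      unfolding lexI_Int_Rdeg n_def by (rule dim_xshadow_supported[OF finite_toplex])
    moreover have "card (\<Union>i. up i ` toplex t (n t)) + (r t - n t) + b \<le> r (Suc t)"
      unfolding r_def
      using n_le[of t] \<open>b \<le> t\<close> tri_b unfolding r_def by (intro card_shadow_toplex) simp_all
    ultimately show ?thesis by linarith
  qed
  moreover have "pol.dim S + 3 * n d \<le> 3 * n t + n (d - 1)"
  proof -
    have "pol.dim (xshadow (I \<inter> Rdeg (d + 1))) + 3 * pol.dim (I \<inter> Rdeg d)
        \<le> 3 * pol.dim (I \<inter> Rdeg (d + 1)) + pol.dim (I \<inter> Rdeg (d - 1))"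
      by (rule I.dim_xshadow_if_socle_zero[OF assms(4)]) (use I_X socle in auto)
    then show ?thesis unfolding S_def V_def n_def t_def by simp
  qed
  \<comment> \<open>The span \<open>S\<close> is at most as large as its lex counterpart, since the
    same Euler count is an equality there and an upper bound here. Hence \<open>S\<close> has
    codimension at least h_{d+1} + b.\<close>
  ultimately have dimS: "pol.dim S + (r t - n t) + b \<le> r (Suc t)" using eq by linarith

  obtain \<gamma> \<delta> where H: "ssum W (lform \<gamma> \<delta> ` Rbelow t) = Rdeg t"
    using exists_complementary_lform[OF W(1,2,4)] dimW \<open>b \<le> t\<close> unfolding r_def by (metis add_le_cancel_left)
  define Y where "Y = ssum S (lform \<alpha> \<beta> ` Rdeg t)"
  have LR: "pol.subspace (lform \<gamma> \<delta> ` Rdeg t)" "pol.fdim (lform \<gamma> \<delta> ` Rdeg t)" for \<gamma> \<delta> :: 'k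
    using subspace_lform_Rbelow[of \<gamma> \<delta> "Suc t"] fdim_lform_Rbelow[of \<gamma> \<delta> "Suc t"] unfolding Rbelow_Suc .
  have Y: "pol.subspace Y" "pol.fdim Y" "S \<subseteq> Y" "lform \<alpha> \<beta> ` Rdeg t \<subseteq> Y"
    unfolding Y_def
    by (rule pol.subspace_ssum[OF S(1) LR(1)] pol.fdim_ssum[OF S(2) LR(2)] pol.ssum_upper(1)[OF LR(1)]
        pol.ssum_upper(2)[OF S(1)])+
  have XS: "pmul (xvar i) f \<in> S" if "f \<in> V" "i < 3" for i f
    unfolding S_def by (rule pmul_xvar_in_xshadow[OF V(1) that])
  have LS: "lform \<gamma> \<delta> f \<in> S" if "f \<in> V" for \<gamma> \<delta> f
    unfolding lform_def using XS[OF that] by (intro pol.subspace_diff pol.subspace_scale S(1)) simp_all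
  \<comment> \<open>A second form M with \<open>W\<close> + M R = R_t gives \<open>Y\<close> + M R_t
    = R_{t+1}. As M maps \<open>W\<close> into \<open>Y\<close>, it induces a surjection from R_t
    modulo \<open>W\<close> onto R_{t+1} modulo \<open>Y\<close>, so the codimension of
    \<open>Y\<close> is at most b.\<close>
  have "r (Suc t) \<le> pol.dim Y + b"
  proof -
    define Z where "Z = ssum Y (lform \<gamma> \<delta> ` Rdeg t)"
    have Z: "pol.subspace Z" "pol.fdim Z" "Y \<subseteq> Z" "lform \<gamma> \<delta> ` Rdeg t \<subseteq> Z"
      unfolding Z_def
      by (rule pol.subspace_ssum[OF Y(1) LR(1)] pol.fdim_ssum[OF Y(2) LR(2)] pol.ssum_upper(1)[OF LR(1)]
          pol.ssum_upper(2)[OF Y(1)])+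
    \<comment> \<open>Each summand in R_t = V + L R + M R stays in the matching part of
      \<open>Z\<close> after multiplication by a variable.\<close>
    have XZ: "pmul (xvar i) f \<in> Z" if f: "f \<in> Rdeg t" "i < 3" for i f
    proof -
      obtain v g g' where vg: "v \<in> V" "g \<in> Rbelow t" "g' \<in> Rbelow t" "f = (v + lform \<alpha> \<beta> g) + lform \<gamma> \<delta> g'"
        using f(1) unfolding H[symmetric] W_def ssum_def by blast
      have "pmul (xvar i) v \<in> Z" using XS[OF vg(1) f(2)] Y(3) Z(3) by blast
      moreover have "lform \<alpha> \<beta> (pmul (xvar i) g) \<in> Z"
        using pmul_xvar_Rbelow[OF vg(2)] Y(4) Z(3) by blast
      moreover have "lform \<gamma> \<delta> (pmul (xvar i) g') \<in> Z"
        using pmul_xvar_Rbelow[OF vg(3)] Z(4) by blast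
      ultimately have "(pmul (xvar i) v + lform \<alpha> \<beta> (pmul (xvar i) g)) + lform \<gamma> \<delta> (pmul (xvar i) g') \<in> Z"
        using Z(1) by (intro pol.subspace_add)
      then show ?thesis unfolding vg(4) by (simp add: lform_commute)
    qed
    have "Rdeg (Suc t) \<subseteq> Z"
    proof
      fix f :: "'k pol" assume "f \<in> Rdeg (Suc t)"
      then have "f = (\<Sum>m\<in>monoms (Suc t). psc (f m) (xmon m))"
        unfolding Rdeg_eq_supported by (intro supported_expand) auto
      also have "\<dots> \<in> Z"
      proof (intro pol.subspace_sum pol.subspace_scale Z(1))
        fix m assume m: "m \<in> monoms (Suc t)"
        then obtain i m' where m': "i < 3" "m = up i m'" by (metis mem_monoms mdeg_SucE)
        then have "xmon m' \<in> (Rdeg t :: 'k pol set)"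
          using m unfolding Rdeg_eq_supported by (intro xmon_in_supported) simp
        then show "xmon m \<in> Z" using XZ[OF _ m'(1)] unfolding m'(2) by (metis pmul_xvar_xmon)
      qed
      finally show "f \<in> Z" .
    qed
    then have "r (Suc t) \<le> pol.dim Z"
      using pol.dim_mono_fdim[OF _ Z(2)] dim_Rdeg unfolding r_def by metis
    moreover have "pol.dim Z + pol.dim {g \<in> Rdeg t. lform \<gamma> \<delta> g \<in> Y} = pol.dim Y + r t"
      unfolding Z_def r_def using pol.dim_ssum_image[OF Y(1,2) subspace_Rdeg fdim_Rdeg linear_lform]
      unfolding dim_Rdeg .
    moreover have "pol.dim W \<le> pol.dim {g \<in> Rdeg t. lform \<gamma> \<delta> g \<in> Y}"
    proof (rule pol.dim_mono_fdim)
      show "pol.fdim {g \<in> Rdeg t. lform \<gamma> \<delta> g \<in> Y}" by (rule pol.fdim_mono[OF fdim_Rdeg]) blast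
      show "W \<subseteq> {g \<in> Rdeg t. lform \<gamma> \<delta> g \<in> Y}"
      proof
        fix w assume w: "w \<in> W"
        then obtain v g where vg: "v \<in> V" "g \<in> Rbelow t" "w = v + lform \<alpha> \<beta> g"
          unfolding W_def ssum_def by blast
        have "lform \<gamma> \<delta> v \<in> Y" using LS[OF vg(1)] Y(3) by blast
        moreover have "lform \<alpha> \<beta> (lform \<gamma> \<delta> g) \<in> Y" using lform_Rbelow[OF vg(2)] Y(4) by blast
        ultimately have "lform \<gamma> \<delta> v + lform \<alpha> \<beta> (lform \<gamma> \<delta> g) \<in> Y" using Y(1) by (intro pol.subspace_add)
        then have "lform \<gamma> \<delta> w \<in> Y" unfolding vg(3) by (simp add: lform_lform_commute[of \<gamma>])
        then show "w \<in> {g \<in> Rdeg t. lform \<gamma> \<delta> g \<in> Y}" using w W(2) by blast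
      qed
    qed
    ultimately show ?thesis using dimW by linarith
  qed

  \<comment> \<open>Injectivity of L from R_t modulo V to R_{t+1} modulo \<open>S\<close>: the lower
    bound for the codimension of \<open>S\<close> and the upper bound for that of \<open>Y\<close>
    leave no room beyond V in the colon space.\<close>
  have colon: "V = {g \<in> Rdeg t. lform \<alpha> \<beta> g \<in> S}"
  proof (rule pol.subspace_eqI_dim[OF V(1)])
    show "V \<subseteq> {g \<in> Rdeg t. lform \<alpha> \<beta> g \<in> S}" using V(3) LS by blast
    show "pol.fdim {g \<in> Rdeg t. lform \<alpha> \<beta> g \<in> S}" by (rule pol.fdim_mono[OF fdim_Rdeg]) blast
    have "pol.dim Y + pol.dim {g \<in> Rdeg t. lform \<alpha> \<beta> g \<in> S} = pol.dim S + r t"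
      unfolding Y_def r_def using pol.dim_ssum_image[OF S subspace_Rdeg fdim_Rdeg linear_lform]
      unfolding dim_Rdeg .
    then show "pol.dim {g \<in> Rdeg t. lform \<alpha> \<beta> g \<in> S} \<le> pol.dim V"
      using dimS \<open>r (Suc t) \<le> pol.dim Y + b\<close> n_le[of t] unfolding V(4) by linarith
  qed

  \<comment> \<open>If L killed nothing in A_d, then any v in A_{d-1} with L v = 0 would have L (x_i
    v) = 0, so x_i v = 0 for all i and v = 0 by the socle condition. L would embed A_{d-1} into A_d,
    against h_{d-1} > h_d.\<close>
  obtain u where u: "u \<in> Rdeg d" "u \<notin> I" "lform \<alpha> \<beta> u \<in> I"
  proof (rule ccontr)
    note u_thesis = that
    assume "\<not> thesis"
    then have inj: "u \<in> I" if "u \<in> Rdeg d" "lform \<alpha> \<beta> u \<in> I" for u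
      using that u_thesis by blast
    have d: "Suc (d - 1) = d" using assms(4) by simp
    have sub: "{g \<in> Rdeg (d - 1). lform \<alpha> \<beta> g \<in> I \<inter> Rdeg d} \<subseteq> I \<inter> Rdeg (d - 1)"
    proof
      fix v assume v: "v \<in> {g \<in> Rdeg (d - 1). lform \<alpha> \<beta> g \<in> I \<inter> Rdeg d}"
      have "pmul (xvar i) v \<in> I" for i
      proof (rule inj)
        show "pmul (xvar i) v \<in> Rdeg d" using pmul_xvar_Rdeg[of v "d - 1" i] v d by simp
        show "lform \<alpha> \<beta> (pmul (xvar i) v) \<in> I" unfolding lform_commute using v I_X by blast
      qed
      then show "v \<in> I \<inter> Rdeg (d - 1)" using v socle[of v "d - 1"] by simp
    qed
    have "ssum (I \<inter> Rdeg d) (lform \<alpha> \<beta> ` Rdeg (d - 1)) \<subseteq> Rdeg d"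
      using ssum_Rdeg_subset[of "I \<inter> Rdeg d" d] d Rbelow_Suc[of "d - 1"] by (metis Int_lower2)
    then have "pol.dim (ssum (I \<inter> Rdeg d) (lform \<alpha> \<beta> ` Rdeg (d - 1))) \<le> r d"
      using pol.dim_mono_fdim[OF _ fdim_Rdeg] dim_Rdeg unfolding r_def by metis
    moreover have "pol.dim {g \<in> Rdeg (d - 1). lform \<alpha> \<beta> g \<in> I \<inter> Rdeg d} \<le> n (d - 1)"
      unfolding n_def by (rule pol.dim_mono_fdim[OF sub I.fdim_deg])
    moreover have "pol.dim (ssum (I \<inter> Rdeg d) (lform \<alpha> \<beta> ` Rdeg (d - 1)))
        + pol.dim {g \<in> Rdeg (d - 1). lform \<alpha> \<beta> g \<in> I \<inter> Rdeg d} = n d + r (d - 1)"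
      unfolding n_def r_def
      using pol.dim_ssum_image[OF I.subspace_deg I.fdim_deg subspace_Rdeg fdim_Rdeg linear_lform]
      unfolding dim_Rdeg .
    ultimately show False using h(1) by linarith
  qed
  \<comment> \<open>As L u lies in V, its multiple L (x_i u) lies in \<open>S\<close>, and the colon
    identity puts x_i u into V. So u is a nonzero socle element of degree d < s.\<close>
  have "pmul (xvar i) u \<in> I" if "i < 3" for i
  proof -
    have "lform \<alpha> \<beta> u \<in> V"
      using u(3) lform_Rbelow[of u t] u(1) unfolding V_def t_def Rbelow_Suc by blast
    then have "lform \<alpha> \<beta> (pmul (xvar i) u) \<in> S" unfolding lform_commute by (rule XS[OF _ that])
    moreover have "pmul (xvar i) u \<in> Rdeg t" unfolding t_def by (rule pmul_xvar_Rdeg[OF u(1)])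
    ultimately show ?thesis using colon unfolding V_def by blast
  qed
  then show False using socle[OF u(1)] u(2) by blast
qed

end
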